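(* Let $k\ge 2$ be fixed, $N=kn$, and let $m=p\binom{N}{2}$ be an integer with $m=\Omega(\binom{N}{2}/\log n)$. Let $G$ be a uniformly random connected graph on $N$ labeled vertices with $m$ edges, and let $T$ be a uniformly random spanning tree of $G$. Then the probability that $T$ is $k$-splittable is at least $C_k\, n^{\frac{1-k}{2}}\, p\, e^{-(2+o(1))/p}$, where $C_k>0$ depends only on $k$ and $o(1)\to 0$ as $n\to\infty$; in particular it is at least $C_k n^{-\frac k2-O(1)}$.
   Context: A tree $T$ is $k$-splittable if there exist $k-1$ edges of $T$ whose removal leaves a forest whose $k$ connected components all have the same number of vertices. The probability is taken over both $G$ and $T$, i.e. it equals $\mathbb{E}_G[\tau_k(G)/\tau(G)]$, where $\tau(G)$ is the number of spanning trees of $G$ and $\tau_k(G)$ the number of $k$-splittable spanning trees of $G$. *)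

theory Defs
  imports Complex_Main
begin

text \<open>Simple graphs on the labeled vertex set V; an edge set E is a set of
  2-element subsets of V.\<close>

definition all_edges :: "nat set \<Rightarrow> nat set set" where
  "all_edges V = {e. e \<subseteq> V \<and> card e = 2}"

definition adj :: "nat set set \<Rightarrow> (nat \<times> nat) set" where
  "adj E = {(u, v). {u, v} \<in> E}"

definition connected_graph :: "nat set \<Rightarrow> nat set set \<Rightarrow> bool" where
  "connected_graph V E \<longleftrightarrow> (\<forall>u\<in>V. \<forall>v\<in>V. (u, v) \<in> (adj E)\<^sup>*)"

text \<open>A cycle: at least 3 distinct vertices, cyclically consecutive ones adjacent.\<close>
definition has_cycle :: "nat set set \<Rightarrow> bool" where
  "has_cycle E \<longleftrightarrow> (\<exists>vs. length vs \<ge> 3 \<and> distinct vs \<and>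
      (\<forall>i < length vs. {vs ! i, vs ! ((i + 1) mod length vs)} \<in> E))"

text \<open>Spanning trees of the graph (V,E): connected acyclic spanning subgraphs.\<close>
definition spanning_trees :: "nat set \<Rightarrow> nat set set \<Rightarrow> nat set set set" where
  "spanning_trees V E = {T. T \<subseteq> E \<and> connected_graph V T \<and> \<not> has_cycle T}"

text \<open>Connected components of (V,E).\<close>
definition components :: "nat set \<Rightarrow> nat set set \<Rightarrow> nat set set" where
  "components V E = {{v \<in> V. (u, v) \<in> (adj E)\<^sup>*} | u. u \<in> V}"

definition k_splittable :: "nat \<Rightarrow> nat set \<Rightarrow> nat set set \<Rightarrow> bool" where
  "k_splittable k V T \<longleftrightarrow> (\<exists>S. S \<subseteq> T \<and> card S = k - 1 \<and>
      card (components V (T - S)) = k \<and>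
      (\<forall>C\<in>components V (T - S). \<forall>D\<in>components V (T - S). card C = card D))"

text \<open>Connected graphs on vertex set {0..<N} with exactly m edges.\<close>
definition conn_graphs :: "nat \<Rightarrow> nat \<Rightarrow> nat set set set" where
  "conn_graphs N m = {E. E \<subseteq> all_edges {..<N} \<and> card E = m \<and> connected_graph {..<N} E}"

definition tau :: "nat \<Rightarrow> nat set set \<Rightarrow> nat" where
  "tau N E = card (spanning_trees {..<N} E)"

definition tau_k :: "nat \<Rightarrow> nat \<Rightarrow> nat set set \<Rightarrow> nat" where
  "tau_k k N E = card {T \<in> spanning_trees {..<N} E. k_splittable k {..<N} T}"

text \<open>Probability that a uniformly random spanning tree of a uniformly random
  connected graph on N labeled vertices with m edges is k-splittable,
  i.e. E_G[tau_k(G)/tau(G)].\<close>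
definition split_prob :: "nat \<Rightarrow> nat \<Rightarrow> nat \<Rightarrow> real" where
  "split_prob k N m =
     (\<Sum>G\<in>conn_graphs N m. real (tau_k k N G) / real (tau N G)) / real (card (conn_graphs N m))"

end

theory Submission
  imports "HOL-Analysis.Harmonic_Numbers" "HOL-Combinatorics.Multiset_Permutations" Defs
begin

text \<open>Write M for the number of pairs of vertices and p = m/M. For fixed trees T and T', the number of
  graphs with m edges containing both depends only on the number of common edges. A forest with
  component sizes a_1, ..., a_c lies in N^(c-2) a_1 ... a_c spanning trees of K_N, hence a forest with f
  edges lies in at most N^(N-2) (2/N)^f of them. Summing over the subforests of T, the expected number
  of spanning trees of a random graph conditioned to contain T is at most 1/l := N^(N-2) p^(N-1).
  Together with tau_k/tau \<ge> 2 l tau_k - l^2 tau_k tau this bounds the probability from below by l times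
  the expectation of tau_k, i.e. by exp(-2/p) times the proportion of k-splittable trees in K_N; so
  the o(1) term can be taken to be 0. The edges cut by an equal split are determined by the tree, so
  the splittable trees are counted by choosing the parts, a tree in each part, and a tree containing
  the resulting forest. Stirling bounds then give the factor n^((1-k)/2).\<close>

subsection \<open>Components and forests\<close>

text \<open>The tangent bound asks only for an upper bound on the mean of \<open>tau\<close> over
  graphs weighted by \<open>tau_k\<close>, that is, over graphs with a splittable tree planted in
  them. Planting a tree with s = N - 1 edges leaves density q = (m - s) / (M - s) on the other
  pairs, and M = N (N - 1) / 2 makes 2 (1 - q) / N + q equal to p exactly. So the planted mean is at
  most N^(N-2) p^s with no error factor, and exp(-2/p) comes solely from comparing the number of
  graphs that contain a fixed tree with p^s times the number of all graphs. Conditioning on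
  connectedness does no harm: disconnected graphs contribute 0 to the sum, and counting all graphs
  in the denominator only lowers the average.\<close>

lemma sym_reach: "(u, v) \<in> (adj E)\<^sup>* \<Longrightarrow> (v, u) \<in> (adj E)\<^sup>*"
proof -
  have "sym (adj E)"
    by (auto simp: sym_def adj_def insert_commute)
  then show "(u, v) \<in> (adj E)\<^sup>* \<Longrightarrow> (v, u) \<in> (adj E)\<^sup>*"
    by (meson sym_rtrancl symD)
qed

lemma reach_mono: "E \<subseteq> E' \<Longrightarrow> (u, v) \<in> (adj E)\<^sup>* \<Longrightarrow> (u, v) \<in> (adj E')\<^sup>*"
  using rtrancl_mono[of "adj E" "adj E'"] by (auto simp: adj_def)

lemma reach_edge: "{u, v} \<in> E \<Longrightarrow> (u, v) \<in> (adj E)\<^sup>*"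
  by (auto simp: adj_def)

lemma reach_closed:
  assumes "(u, v) \<in> (adj E)\<^sup>*" "u \<in> A" "\<And>x y. {x, y} \<in> E \<Longrightarrow> x \<in> A \<Longrightarrow> y \<in> A"
  shows "v \<in> A"
  using assms(1,2) by (induction rule: rtrancl_induct) (use assms(3) in \<open>auto simp: adj_def\<close>)

text \<open>A walk in the enlarged graph can be shortened until it crosses the new edge at most
  once, in one of the two directions.\<close>

lemma reach_insert:
  "(x, y) \<in> (adj (insert {u, v} E))\<^sup>* \<longleftrightarrow>
    (x, y) \<in> (adj E)\<^sup>* \<or> (x, u) \<in> (adj E)\<^sup>* \<and> (v, y) \<in> (adj E)\<^sup>* \<or>
    (x, v) \<in> (adj E)\<^sup>* \<and> (u, y) \<in> (adj E)\<^sup>*"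
proof -
  have "adj (insert {u, v} E) = insert (u, v) (insert (v, u) (adj E))"
    by (auto simp: adj_def doubleton_eq_iff)
  then show ?thesis
    by (auto simp: rtrancl_insert intro: rtrancl_trans sym_reach)
qed

definition comp_of :: "nat set \<Rightarrow> nat set set \<Rightarrow> nat \<Rightarrow> nat set" where
  "comp_of V E u = {v \<in> V. (u, v) \<in> (adj E)\<^sup>*}"

lemma components_eq: "components V E = comp_of V E ` V"
  by (auto simp: components_def comp_of_def)

lemma comp_of_self: "u \<in> V \<Longrightarrow> u \<in> comp_of V E u"
  by (simp add: comp_of_def)

lemma comp_of_eq_iff:
  assumes "u \<in> V" "v \<in> V"
  shows "comp_of V E u = comp_of V E v \<longleftrightarrow> (u, v) \<in> (adj E)\<^sup>*"
  using assms by (auto simp: comp_of_def intro: rtrancl_trans sym_reach)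

lemma comp_of_eq: "v \<in> comp_of V E u \<Longrightarrow> u \<in> V \<Longrightarrow> comp_of V E v = comp_of V E u"
  by (auto simp: comp_of_def intro: rtrancl_trans sym_reach)

lemma mem_components: "C \<in> components V E \<Longrightarrow> u \<in> C \<Longrightarrow> C = comp_of V E u"
  using comp_of_eq by (auto simp: components_eq)

lemma components_disjoint: "pairwise disjnt (components V E)"
  unfolding pairwise_def disjnt_def using mem_components by blast

lemma Union_components: "\<Union> (components V E) = V"
  by (auto simp: components_eq comp_of_def)

lemma finite_components: "finite V \<Longrightarrow> finite (components V E)"
  by (simp add: components_eq)

lemma finite_comp_of: "finite V \<Longrightarrow> finite (comp_of V E u)"
  by (simp add: comp_of_def)

lemma card_comp_of_pos: "finite V \<Longrightarrow> u \<in> V \<Longrightarrow> card (comp_of V E u) > 0"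
  using comp_of_self finite_comp_of card_gt_0_iff by blast

lemma finite_component: "finite V \<Longrightarrow> C \<in> components V E \<Longrightarrow> finite C"
  by (auto simp: components_eq finite_comp_of)

lemma card_component_pos: "finite V \<Longrightarrow> C \<in> components V E \<Longrightarrow> card C > 0"
  by (auto simp: components_eq card_comp_of_pos)

lemma sum_over_components:
  assumes "finite V"
  shows "(\<Sum>C\<in>components V E. \<Sum>x\<in>C. f x) = (\<Sum>x\<in>V. f x)"
  using sum.Union_disjoint[of "components V E" f] assms components_disjoint[of V E]
  by (auto simp: Union_components finite_component pairwise_def disjnt_def)

lemma sum_card_components: "finite V \<Longrightarrow> (\<Sum>C\<in>components V E. card C) = card V"
  using sum_over_components[of V "\<lambda>_. 1::nat" E] by simp

lemma connected_iff_card_components: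
  assumes "finite V" "V \<noteq> {}"
  shows "connected_graph V E \<longleftrightarrow> card (components V E) = 1"
proof
  assume c: "connected_graph V E"
  then have "comp_of V E u = V" if "u \<in> V" for u
    using that by (auto simp: connected_graph_def comp_of_def)
  then have "components V E = {V}"
    using assms by (auto simp: components_eq)
  then show "card (components V E) = 1" by simp
next
  assume "card (components V E) = 1"
  then obtain C where "components V E = {C}"
    using card_1_singletonE by blast
  then have "comp_of V E u = comp_of V E v" if "u \<in> V" "v \<in> V" for u v
    using that by (metis components_eq imageI singletonD)
  then show "connected_graph V E"
    using comp_of_eq_iff by (auto simp: connected_graph_def)
qed

text \<open>Covers both cases: if u and v already share a component, the \<open>insert\<close>
  restores the set that the difference removes.\<close>

lemma components_insert:
  assumes "u \<in> V" "v \<in> V"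
  shows "components V (insert {u, v} E) =
    insert (comp_of V E u \<union> comp_of V E v) (components V E - {comp_of V E u, comp_of V E v})"
proof -
  have c: "comp_of V (insert {u, v} E) x =
      (if (x, u) \<in> (adj E)\<^sup>* \<or> (x, v) \<in> (adj E)\<^sup>* then comp_of V E u \<union> comp_of V E v
       else comp_of V E x)" for x
    by (auto simp: comp_of_def reach_insert intro: rtrancl_trans sym_reach)
  show ?thesis
  proof (intro equalityI subsetI)
    fix C assume "C \<in> components V (insert {u, v} E)"
    then obtain x where "x \<in> V" "C = comp_of V (insert {u, v} E) x"
      by (auto simp: components_eq)
    then show "C \<in> insert (comp_of V E u \<union> comp_of V E v) (components V E - {comp_of V E u, comp_of V E v})"
      using assms comp_of_eq_iff[of x V u E] comp_of_eq_iff[of x V v E]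
      by (auto simp: c components_eq)
  next
    fix C assume *: "C \<in> insert (comp_of V E u \<union> comp_of V E v) (components V E - {comp_of V E u, comp_of V E v})"
    show "C \<in> components V (insert {u, v} E)"
    proof (cases "C = comp_of V E u \<union> comp_of V E v")
      case True
      then have "C = comp_of V (insert {u, v} E) u" by (simp add: c)
      then show ?thesis using assms by (auto simp: components_eq)
    next
      case False
      then obtain x where "x \<in> V" "C = comp_of V E x" "C \<noteq> comp_of V E u" "C \<noteq> comp_of V E v"
        using * by (auto simp: components_eq)
      then have "C = comp_of V (insert {u, v} E) x"
        using assms by (simp add: c comp_of_eq_iff)
      then show ?thesis using \<open>x \<in> V\<close> by (auto simp: components_eq)
    qed
  qed
qed

lemma merged_component_new:
  assumes "u \<in> V" "v \<in> V"
  shows "comp_of V E u \<union> comp_of V E v \<notin> components V E - {comp_of V E u, comp_of V E v}"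
  using assms mem_components[of _ V E u] comp_of_self[of u V E] by blast

lemma card_components_insert:
  assumes "finite V" "u \<in> V" "v \<in> V" "(u, v) \<notin> (adj E)\<^sup>*"
  shows "Suc (card (components V (insert {u, v} E))) = card (components V E)"
proof -
  have ne: "comp_of V E u \<noteq> comp_of V E v"
    using assms comp_of_eq_iff by blast
  have sub: "{comp_of V E u, comp_of V E v} \<subseteq> components V E"
    using assms by (auto simp: components_eq)
  then have "card {comp_of V E u, comp_of V E v} \<le> card (components V E)"
    using assms by (intro card_mono finite_components)
  then show ?thesis
    using assms ne sub merged_component_new[of u V v E]
    by (simp add: components_insert finite_components card_Diff_subset)
qed

text \<open>The bridge criterion for acyclicity. Unlike \<open>has_cycle\<close> it is phrased by
  reachability, so \<open>reach_insert\<close> applies when edges are added one at a time.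
  Reflexivity of reachability also rules out loops.\<close>

definition forest :: "nat set set \<Rightarrow> bool" where
  "forest E \<longleftrightarrow> (\<forall>u v. {u, v} \<in> E \<longrightarrow> (u, v) \<notin> (adj (E - {{u, v}}))\<^sup>*)"

lemma forest_empty: "forest {}"
  by (simp add: forest_def)

lemma forest_subset: "forest E \<Longrightarrow> F \<subseteq> E \<Longrightarrow> forest F"
  unfolding forest_def by (meson Diff_mono order_refl reach_mono subsetD)

text \<open>If an old edge stopped being a bridge, its detour would have to cross the new edge; the
  rest of the detour together with the old edge would then already join u and v in
  \<open>E\<close>.\<close>

lemma forest_insertI:
  assumes "forest E" "(u, v) \<notin> (adj E)\<^sup>*"
  shows "forest (insert {u, v} E)"
  unfolding forest_def
proof (intro allI impI notI)
  fix x y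
  assume xy: "{x, y} \<in> insert {u, v} E" and r: "(x, y) \<in> (adj (insert {u, v} E - {{x, y}}))\<^sup>*"
  have uv: "{u, v} \<notin> E" using assms(2) reach_edge by blast
  show False
  proof (cases "{x, y} = {u, v}")
    case True
    then have "(x, y) \<in> (adj E)\<^sup>*"
      using r uv by (simp add: insert_Diff_if)
    then show False using True assms(2) sym_reach
      by (auto simp: doubleton_eq_iff)
  next
    case False
    then have E: "{x, y} \<in> E" using xy by blast
    have *: "(a, b) \<in> (adj E)\<^sup>*" if "(a, b) \<in> (adj (E - {{x, y}}))\<^sup>*" for a b
      using that reach_mono[of "E - {{x, y}}" E] by blast
    have "insert {u, v} E - {{x, y}} = insert {u, v} (E - {{x, y}})"
      using False by blast
    with r have "(x, u) \<in> (adj (E - {{x, y}}))\<^sup>* \<and> (v, y) \<in> (adj (E - {{x, y}}))\<^sup>* \<or>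
      (x, v) \<in> (adj (E - {{x, y}}))\<^sup>* \<and> (u, y) \<in> (adj (E - {{x, y}}))\<^sup>*"
      using assms(1) E by (auto simp: reach_insert forest_def)
    then have "(u, v) \<in> (adj E)\<^sup>*"
      using reach_edge[OF E] by (meson * rtrancl_trans sym_reach)
    then show False using assms(2) by blast
  qed
qed

lemma forest_insertD:
  assumes "forest (insert {u, v} E)" "{u, v} \<notin> E"
  shows "(u, v) \<notin> (adj E)\<^sup>*"
  using assms unfolding forest_def by (metis Diff_insert_absorb insertI1)

lemma all_edgesE:
  assumes "e \<in> all_edges V"
  obtains u v where "e = {u, v}" "u \<in> V" "v \<in> V" "u \<noteq> v"
  using assms by (auto simp: all_edges_def card_2_iff)

lemma finite_all_edges: "finite V \<Longrightarrow> finite (all_edges V)"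
  by (rule finite_subset[of _ "Pow V"]) (auto simp: all_edges_def)

lemma card_all_edges: "finite V \<Longrightarrow> card (all_edges V) = card V choose 2"
  using n_subsets[of V 2] by (simp add: all_edges_def)

lemma components_empty: "components V {} = (\<lambda>v. {v}) ` V"
  by (auto simp: components_def adj_def)

lemma card_forest:
  assumes "finite V" "F \<subseteq> all_edges V" "forest F"
  shows "card F + card (components V F) = card V"
proof -
  have "finite F" using assms finite_all_edges finite_subset by blast
  then show ?thesis using assms(2,3)
  proof (induction F)
    case empty
    then show ?case by (simp add: components_empty card_image)
  next
    case (insert e F)
    from insert.prems obtain u v where e: "e = {u, v}" "u \<in> V" "v \<in> V"
      using all_edgesE by (metis insert_subset)
    have "(u, v) \<notin> (adj F)\<^sup>*"
      using insert.prems insert.hyps e forest_insertD by blast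
    with card_components_insert[OF assms(1) e(2,3) this] insert e show ?case
      using forest_subset[of "insert e F" F] subset_insertI[of F e] by auto
  qed
qed

section \<open>Agreement of the bridge criterion with the absence of cycles\<close>

lemma successive_reach:
  assumes "\<And>i. a \<le> i \<Longrightarrow> i < b \<Longrightarrow> {f i, f (Suc i)} \<in> E" "a \<le> b"
  shows "(f a, f b) \<in> (adj E)\<^sup>*"
  using assms(2,1)
proof (induction b rule: dec_induct)
  case (step n)
  then have "(f a, f n) \<in> (adj E)\<^sup>*" "{f n, f (Suc n)} \<in> E" by auto
  then show ?case by (meson reach_edge rtrancl_trans)
qed simp

text \<open>The closing edge of the cycle is not a bridge, because the rest of the cycle joins its
  ends. Length at least 3 ensures that no other edge of the cycle coincides with the closing
  one.\<close>

lemma not_forest_if_has_cycle: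
  assumes "has_cycle E"
  shows "\<not> forest E"
proof -
  obtain vs where vs: "length vs \<ge> 3" "distinct vs"
    and e: "\<And>i. i < length vs \<Longrightarrow> {vs ! i, vs ! ((i + 1) mod length vs)} \<in> E"
    using assms by (auto simp: has_cycle_def)
  define l where "l = length vs"
  define E' where "E' = E - {{vs ! 0, vs ! (l - 1)}}"
  have l: "l \<ge> 3" using vs by (simp add: l_def)
  have "{vs ! i, vs ! Suc i} \<in> E'" if "i < l - 1" for i
  proof -
    have "{vs ! i, vs ! Suc i} \<in> E" using e[of i] that by (simp add: l_def)
    moreover have "{vs ! i, vs ! Suc i} \<noteq> {vs ! 0, vs ! (l - 1)}"
    proof
      assume "{vs ! i, vs ! Suc i} = {vs ! 0, vs ! (l - 1)}"
      then have "vs ! i = vs ! 0 \<and> vs ! Suc i = vs ! (l - 1) \<or> vs ! Suc i = vs ! 0"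
        by (auto simp: doubleton_eq_iff)
      moreover have "i < length vs" "Suc i < length vs" "0 < length vs" "l - 1 < length vs"
        using that l by (auto simp: l_def)
      ultimately have "i = 0 \<and> Suc i = l - 1"
        using vs(2) nth_eq_iff_index_eq by blast
      then show False using l by linarith
    qed
    ultimately show ?thesis by (simp add: E'_def)
  qed
  then have "(vs ! 0, vs ! (l - 1)) \<in> (adj E')\<^sup>*"
    using successive_reach[of 0 "l - 1" "\<lambda>i. vs ! i" E'] by simp
  moreover have "{vs ! 0, vs ! (l - 1)} \<in> E"
  proof -
    have "(l - 1 + 1) mod l = 0"
      by (subst le_add_diff_inverse2) (use l in auto)
    then show ?thesis using e[of "l - 1"] l by (simp add: l_def insert_commute)
  qed
  ultimately show ?thesis by (auto simp: forest_def E'_def)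
qed

text \<open>Loop erasure: a step back to a vertex already on the path truncates the path at that
  vertex.\<close>

lemma reach_simple_path:
  assumes "(u, v) \<in> (adj E)\<^sup>*"
  shows "\<exists>vs. vs \<noteq> [] \<and> hd vs = u \<and> last vs = v \<and> distinct vs \<and>
    (\<forall>i. Suc i < length vs \<longrightarrow> {vs ! i, vs ! Suc i} \<in> E)"
  using assms
proof (induction rule: rtrancl_induct)
  case base
  show ?case by (rule exI[of _ "[u]"]) simp
next
  case (step y z)
  then obtain vs where vs: "vs \<noteq> []" "hd vs = u" "last vs = y" "distinct vs"
    and e: "\<And>i. Suc i < length vs \<Longrightarrow> {vs ! i, vs ! Suc i} \<in> E" by blast
  show ?case
  proof (cases "z \<in> set vs")
    case True
    then obtain j where j: "j < length vs" "vs ! j = z" by (auto simp: in_set_conv_nth)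
    then have "last (take (Suc j) vs) = z"
      by (simp add: take_Suc_conv_app_nth)
    then show ?thesis
      using vs e by (intro exI[of _ "take (Suc j) vs"]) (auto simp: hd_conv_nth)
  next
    case False
    have "{vs ! (length vs - 1), z} \<in> E"
      using step.hyps vs by (simp add: adj_def last_conv_nth)
    then have "{vs ! i, z} \<in> E" if "Suc i = length vs" for i
      using that by (metis diff_Suc_1)
    then have "{(vs @ [z]) ! i, (vs @ [z]) ! Suc i} \<in> E" if "Suc i < length (vs @ [z])" for i
      using that e[of i] vs(1) by (cases "Suc i = length vs") (auto simp: nth_append)
    then show ?thesis
      using vs False by (intro exI[of _ "vs @ [z]"]) auto
  qed
qed

text \<open>A simple detour around a non-bridge, closed by that edge, is the cycle. It has at least
  3 vertices: one is impossible since \<open>all_edges\<close> contains no loops, and two since the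
  edge itself is removed.\<close>

lemma has_cycle_if_not_forest:
  assumes "E \<subseteq> all_edges V" "\<not> forest E"
  shows "has_cycle E"
proof -
  obtain u v where uv: "{u, v} \<in> E" "(u, v) \<in> (adj (E - {{u, v}}))\<^sup>*"
    using assms by (auto simp: forest_def)
  then have "u \<noteq> v" using assms by (auto simp: all_edges_def)
  obtain vs where vs: "vs \<noteq> []" "hd vs = u" "last vs = v" "distinct vs"
    and e: "\<And>i. Suc i < length vs \<Longrightarrow> {vs ! i, vs ! Suc i} \<in> E - {{u, v}}"
    using reach_simple_path[OF uv(2)] by blast
  have hl: "vs ! 0 = u" "vs ! (length vs - 1) = v"
    using vs by (auto simp: hd_conv_nth last_conv_nth)
  have "length vs \<noteq> 1" using hl \<open>u \<noteq> v\<close> by auto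
  moreover have "length vs \<noteq> 2" using hl e[of 0] by (auto simp: numeral_2_eq_2)
  moreover have "length vs \<noteq> 0" using vs by simp
  ultimately have len: "length vs \<ge> 3" by linarith
  have "{vs ! i, vs ! ((i + 1) mod length vs)} \<in> E" if "i < length vs" for i
  proof (cases "Suc i < length vs")
    case True
    then show ?thesis using e[of i] by simp
  next
    case False
    then have "i = length vs - 1" using that by simp
    moreover have "(length vs - 1 + 1) mod length vs = 0"
      by (subst le_add_diff_inverse2) (use len in auto)
    ultimately show ?thesis using hl uv(1) by (simp only: insert_commute)
  qed
  then show ?thesis using len vs by (auto simp: has_cycle_def)
qed

lemma has_cycle_iff: "E \<subseteq> all_edges V \<Longrightarrow> has_cycle E \<longleftrightarrow> \<not> forest E"
  using not_forest_if_has_cycle has_cycle_if_not_forest by blast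

subsection \<open>Spanning trees containing a given forest\<close>

lemma spanning_tree_iff:
  assumes "finite V" "V \<noteq> {}"
  shows "T \<in> spanning_trees V (all_edges V) \<longleftrightarrow>
    T \<subseteq> all_edges V \<and> forest T \<and> card (components V T) = 1"
  using assms has_cycle_iff[of T V]
  by (auto simp: spanning_trees_def connected_iff_card_components)

lemma card_spanning_tree:
  assumes "finite V" "V \<noteq> {}" "T \<in> spanning_trees V (all_edges V)"
  shows "card T = card V - 1"
  using assms card_forest[of V T] by (auto simp: spanning_tree_iff)

lemma finite_spanning_trees: "finite V \<Longrightarrow> finite (spanning_trees V (all_edges V))"
  by (rule finite_subset[of _ "Pow (all_edges V)"]) (auto simp: spanning_trees_def finite_all_edges)

lemma finite_spanning_tree: "finite V \<Longrightarrow> T \<in> spanning_trees V (all_edges V) \<Longrightarrow> finite T"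
  using finite_all_edges finite_subset by (auto simp: spanning_trees_def)

lemma forest_insert_iff:
  assumes "forest F"
  shows "forest (insert {u, v} F) \<and> {u, v} \<notin> F \<longleftrightarrow> (u, v) \<notin> (adj F)\<^sup>*"
  using assms forest_insertI forest_insertD reach_edge by blast

text \<open>Merging parts of sizes a and b replaces the factor a b by a + b, that is, multiplies by
  1/a + 1/b. Writing this as a sum over endpoints lets a later sum over edges be exchanged for a sum
  over vertices.\<close>

lemma prod_card_components_insert:
  assumes "finite V" "u \<in> V" "v \<in> V" "(u, v) \<notin> (adj E)\<^sup>*"
  shows "(\<Prod>C\<in>components V (insert {u, v} E). real (card C)) =
    (\<Prod>C\<in>components V E. real (card C)) * (\<Sum>x\<in>{u, v}. 1 / real (card (comp_of V E x)))"
proof -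
  let ?u = "comp_of V E u" and ?v = "comp_of V E v"
  define K where "K = components V E"
  have ne: "?u \<noteq> ?v" and uv: "u \<noteq> v"
    using assms comp_of_eq_iff[of u V v E] by auto
  have sub: "{?u, ?v} \<subseteq> K"
    using assms by (auto simp: components_eq K_def)
  have fin: "finite K" "finite ?u" "finite ?v"
    using assms by (auto simp: finite_components finite_comp_of K_def)
  have "?u \<inter> ?v = {}"
    using components_disjoint[of V E] ne sub by (auto simp: pairwise_def disjnt_def K_def)
  then have card: "card (?u \<union> ?v) = card ?u + card ?v"
    using fin by (simp add: card_Un_disjoint)
  have pos: "card ?u > 0" "card ?v > 0"
    using assms card_comp_of_pos by auto
  have "(\<Prod>C\<in>K. real (card C)) = (\<Prod>C\<in>K - {?u, ?v}. real (card C)) * (\<Prod>C\<in>{?u, ?v}. real (card C))"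
    using sub fin(1) by (rule prod.subset_diff)
  also have "\<dots> = (\<Prod>C\<in>K - {?u, ?v}. real (card C)) * (real (card ?u) * real (card ?v))"
    using ne by simp
  finally have K: "(\<Prod>C\<in>K. real (card C)) =
    (\<Prod>C\<in>K - {?u, ?v}. real (card C)) * (real (card ?u) * real (card ?v))" .
  have "(\<Prod>C\<in>components V (insert {u, v} E). real (card C)) =
      real (card (?u \<union> ?v)) * (\<Prod>C\<in>K - {?u, ?v}. real (card C))"
    using fin assms merged_component_new[of u V v E]
    by (simp add: components_insert K_def[symmetric])
  also have "\<dots> = (\<Prod>C\<in>K. real (card C)) * (1 / real (card ?u) + 1 / real (card ?v))"
    unfolding K card using pos by (simp add: field_simps)
  finally show ?thesis using uv by (simp add: K_def)
qed

text \<open>Each component of size a contributes a terms equal to 1/a.\<close>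

lemma sum_inverse_card_comp_of:
  assumes "finite V"
  shows "(\<Sum>x\<in>V. 1 / real (card (comp_of V E x))) = real (card (components V E))"
proof -
  have "(\<Sum>x\<in>C. 1 / real (card (comp_of V E x))) = 1" if "C \<in> components V E" for C
  proof -
    have "(\<Sum>x\<in>C. 1 / real (card (comp_of V E x))) = (\<Sum>x\<in>C. 1 / real (card C))"
      using that mem_components by (intro sum.cong) auto
    then show ?thesis using card_component_pos[OF assms that] by simp
  qed
  then show ?thesis
    using sum_over_components[OF assms, of "\<lambda>x. 1 / real (card (comp_of V E x))" E, symmetric] by simp
qed

text \<open>Double counting of incidences: a vertex in a component of size a lies on N - a joining
  edges and so contributes N/a - 1. Summed over the vertices this is N c - N for c
  components.\<close>

lemma sum_joining_edges:
  assumes "finite V" "F \<subseteq> all_edges V" "forest F"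
  shows "(\<Sum>e | e \<in> all_edges V \<and> forest (insert e F) \<and> e \<notin> F.
      \<Sum>x\<in>e. 1 / real (card (comp_of V F x))) =
    real (card V) * (real (card (components V F)) - 1)"
proof -
  define J where "J = {e. e \<in> all_edges V \<and> forest (insert e F) \<and> e \<notin> F}"
  define a where "a x = real (card (comp_of V F x))" for x
  have J: "finite J" using finite_all_edges[OF assms(1)] by (simp add: J_def)
  have Jx: "card {e \<in> J. x \<in> e} = card V - card (comp_of V F x)" if "x \<in> V" for x
  proof -
    have "{e \<in> J. x \<in> e} = (\<lambda>y. {x, y}) ` (V - comp_of V F x)"
    proof (intro equalityI subsetI)
      fix e assume "e \<in> {e \<in> J. x \<in> e}"
      then have e: "e \<in> J" "x \<in> e" "e \<in> all_edges V" by (auto simp: J_def)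
      then obtain a b where "e = {a, b}" "a \<in> V" "b \<in> V" by (blast elim: all_edgesE)
      with e obtain y where "e = {x, y}" "y \<in> V" "e \<in> J"
        by (metis insert_commute insertE singletonD)
      then show "e \<in> (\<lambda>y. {x, y}) ` (V - comp_of V F x)"
        using forest_insert_iff[OF assms(3), of x y] by (auto simp: J_def comp_of_def)
    next
      fix e assume "e \<in> (\<lambda>y. {x, y}) ` (V - comp_of V F x)"
      then obtain y where "e = {x, y}" "y \<in> V" "(x, y) \<notin> (adj F)\<^sup>*"
        by (auto simp: comp_of_def)
      then show "e \<in> {e \<in> J. x \<in> e}"
        using forest_insert_iff[OF assms(3), of x y] that
        by (auto simp: J_def all_edges_def card_2_iff)
    qed
    moreover have "inj_on (\<lambda>y. {x, y}) (V - comp_of V F x)"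
      by (auto simp: inj_on_def doubleton_eq_iff)
    ultimately show ?thesis
      using assms(1) by (simp add: card_image card_Diff_subset finite_comp_of comp_of_def)
  qed
  have "(\<Sum>e\<in>J. \<Sum>x\<in>e. 1 / a x) = (\<Sum>e\<in>J. \<Sum>x | x \<in> V \<and> x \<in> e. 1 / a x)"
    by (intro sum.cong refl) (auto simp: J_def all_edges_def)
  also have "\<dots> = (\<Sum>x\<in>V. \<Sum>e | e \<in> J \<and> x \<in> e. 1 / a x)"
    using J assms(1) by (rule sum.swap_restrict)
  also have "\<dots> = (\<Sum>x\<in>V. real (card V) * (1 / a x) - 1)"
  proof (intro sum.cong refl)
    fix x assume x: "x \<in> V"
    have "card (comp_of V F x) \<le> card V"
      using assms(1) by (intro card_mono) (auto simp: comp_of_def)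
    then show "(\<Sum>e | e \<in> J \<and> x \<in> e. 1 / a x) = real (card V) * (1 / a x) - 1"
      using Jx[OF x] card_comp_of_pos[OF assms(1) x, of F]
      by (simp add: a_def of_nat_diff field_simps)
  qed
  also have "\<dots> = real (card V) * (real (card (components V F)) - 1)"
    unfolding sum_subtractf sum_distrib_left[symmetric] a_def sum_inverse_card_comp_of[OF assms(1)]
    by (simp add: algebra_simps)
  finally show ?thesis by (simp add: J_def a_def)
qed

text \<open>Counting the pairs (tree above F, edge of that tree outside F) expresses the count for F
  through the counts for the forests with one more edge.\<close>

lemma card_trees_containing_forest:
  assumes "finite V" "V \<noteq> {}" "F \<subseteq> all_edges V" "forest F"
  shows "real (card {T \<in> spanning_trees V (all_edges V). F \<subseteq> T}) * real (card V) ^ 2 =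
    real (card V) ^ card (components V F) * (\<Prod>C\<in>components V F. real (card C))"
  using assms(3,4)
proof (induction "card (components V F)" arbitrary: F)
  case 0
  then show ?case using assms finite_components[of V F] by (auto simp: components_eq)
next
  case (Suc c)
  define N where "N = card V"
  define t where "t F = {T \<in> spanning_trees V (all_edges V). F \<subseteq> T}" for F
  have cF: "card F + Suc c = N"
    using card_forest[OF assms(1) Suc.prems] Suc.hyps by (simp add: N_def)
  have finF: "finite F" using Suc.prems finite_all_edges[OF assms(1)] finite_subset by blast
  show ?case
  \<comment> \<open>The recursion is solved for the wanted count by cancelling \<open>c\<close>, the
    number of edges missing from \<open>F\<close>. For \<open>c = 0\<close> the forest is itself the
    only tree above it.\<close>
  proof (cases "c = 0")
    case True
    have "T = F" if "T \<in> spanning_trees V (all_edges V)" "F \<subseteq> T" for T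
      using card_spanning_tree[OF assms(1,2) that(1)] cF True that N_def
        finite_spanning_tree[OF assms(1) that(1)] card_subset_eq[of T F] by auto
    moreover have "F \<in> spanning_trees V (all_edges V)"
      using assms Suc.prems Suc.hyps True by (simp add: spanning_tree_iff)
    ultimately have "t F = {F}" by (auto simp: t_def)
    moreover obtain C where "components V F = {C}"
      using Suc.hyps True by (metis One_nat_def card_1_singletonE)
    then have "(\<Prod>C\<in>components V F. real (card C)) = N"
      using sum_card_components[OF assms(1), of F] by (simp add: N_def)
    ultimately show ?thesis using Suc.hyps(2)[symmetric] True
      by (simp add: t_def[symmetric] N_def power2_eq_square)
  next
    case False
    define J where "J = {e. e \<in> all_edges V \<and> forest (insert e F) \<and> e \<notin> F}"
    have fint: "finite (t F)" using finite_spanning_trees[OF assms(1)] by (simp add: t_def)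
    have finJ: "finite J" using finite_all_edges[OF assms(1)] by (simp add: J_def)
    have "(\<Sum>e\<in>J. card (t (insert e F))) = (\<Sum>e\<in>J. \<Sum>T | T \<in> t F \<and> e \<in> T. 1)"
      by (intro sum.cong refl) (auto simp: t_def intro!: arg_cong[of _ _ card])
    also have "\<dots> = (\<Sum>T\<in>t F. \<Sum>e | e \<in> J \<and> e \<in> T. 1)"
      using finJ fint by (rule sum.swap_restrict)
    also have "\<dots> = (\<Sum>T\<in>t F. c)"
    proof (intro sum.cong refl)
      fix T assume T: "T \<in> t F"
      then have T': "T \<in> spanning_trees V (all_edges V)" "F \<subseteq> T" by (auto simp: t_def)
      then have "T \<subseteq> all_edges V" "forest T" using assms by (auto simp: spanning_tree_iff)
      then have "{e \<in> J. e \<in> T} = T - F"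
        using T'(2) forest_subset[of T] by (auto simp: J_def)
      moreover have "card (T - F) = c"
        using card_spanning_tree[OF assms(1,2) T'(1)] cF T'(2) finF N_def
        by (simp add: card_Diff_subset)
      ultimately show "(\<Sum>e | e \<in> J \<and> e \<in> T. 1) = c" by simp
    qed
    finally have dc: "(\<Sum>e\<in>J. card (t (insert e F))) = card (t F) * c" by simp
    let ?P = "\<Prod>C\<in>components V F. real (card C)"
    have step: "real (card (t (insert e F))) * real N ^ 2 =
        real N ^ c * (?P * (\<Sum>x\<in>e. 1 / real (card (comp_of V F x))))" if "e \<in> J" for e
    proof -
      from that obtain u v where e: "e = {u, v}" "u \<in> V" "v \<in> V"
        using that unfolding J_def by (blast elim: all_edgesE)
      have nr: "(u, v) \<notin> (adj F)\<^sup>*"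
        using that e forest_insert_iff[OF Suc.prems(2), of u v] by (auto simp: J_def)
      have "c = card (components V (insert e F))"
        using card_components_insert[OF assms(1) e(2,3) nr] Suc.hyps(2) e by simp
      from Suc.hyps(1)[OF this] show ?thesis
        using that Suc.prems e prod_card_components_insert[OF assms(1) e(2,3) nr]
          \<open>c = card (components V (insert e F))\<close>[symmetric]
        by (auto simp: t_def N_def J_def)
    qed
    have "real c * (real (card (t F)) * real N ^ 2) = real (card (t F) * c) * real N ^ 2"
      by simp
    also have "\<dots> = (\<Sum>e\<in>J. real (card (t (insert e F))) * real N ^ 2)"
      unfolding dc[symmetric] by (simp add: sum_distrib_right)
    also have "\<dots> = (\<Sum>e\<in>J. real N ^ c * (?P * (\<Sum>x\<in>e. 1 / real (card (comp_of V F x)))))"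
      using step by (rule sum.cong[OF refl])
    also have "\<dots> = real N ^ c * (?P * (\<Sum>e\<in>J. \<Sum>x\<in>e. 1 / real (card (comp_of V F x))))"
      by (simp only: sum_distrib_left)
    also have "\<dots> = real N ^ c * (?P * (real N * real c))"
      using sum_joining_edges[OF assms(1) Suc.prems] Suc.hyps(2)[symmetric] by (simp add: J_def N_def)
    also have "\<dots> = real c * (real N ^ Suc c * ?P)"
      by simp
    finally have "real (card (t F)) * real N ^ 2 = real N ^ Suc c * ?P"
      using False by (simp only: mult_cancel_left of_nat_eq_0_iff simp_thms)
    then show ?thesis using Suc.hyps(2) by (simp add: t_def N_def)
  qed
qed

lemma Cayley:
  assumes "finite V" "V \<noteq> {}"
  shows "real (card (spanning_trees V (all_edges V))) * real (card V) ^ 2 = real (card V) ^ card V"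
  using card_trees_containing_forest[OF assms, of "{}"]
  by (simp add: forest_empty components_empty card_image prod.reindex)

text \<open>A component of size a satisfies a <= 2^(a-1), and the exponents a - 1 add up to the
  number of edges.\<close>

lemma prod_card_components_le:
  assumes "finite V" "F \<subseteq> all_edges V" "forest F"
  shows "(\<Prod>C\<in>components V F. real (card C)) \<le> 2 ^ card F"
proof -
  have le: "card C \<le> 2 ^ (card C - 1)" if "C \<in> components V F" for C
    using less_exp[of "card C - 1"] card_component_pos[OF assms(1) that] by linarith
  have "(\<Prod>C\<in>components V F. real (card C)) \<le> (\<Prod>C\<in>components V F. 2 ^ (card C - 1))"
    using le by (intro prod_mono conjI) (simp, metis of_nat_le_iff of_nat_numeral of_nat_power)
  also have "\<dots> = 2 ^ (\<Sum>C\<in>components V F. card C - 1)"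
    by (simp add: power_sum)
  also have "(\<Sum>C\<in>components V F. card C - 1) = card V - card (components V F)"
  proof (subst sum_subtractf_nat)
    show "1 \<le> card C" if "C \<in> components V F" for C
      using card_component_pos[OF assms(1) that] by simp
  qed (simp add: sum_card_components[OF assms(1)])
  also have "\<dots> = card F" using card_forest[OF assms] by linarith
  finally show ?thesis .
qed

text \<open>A given edge lies in the proportion 2/N of the spanning trees of the complete graph, so
  this is a negative correlation bound: several edges of a forest occur together at most as often as
  if they were independent.\<close>

lemma card_trees_containing_forest_le:
  assumes "finite V" "V \<noteq> {}" "F \<subseteq> all_edges V" "forest F"
  shows "real (card {T \<in> spanning_trees V (all_edges V). F \<subseteq> T}) * real (card V) ^ 2 \<le>
    real (card V) ^ card V * (2 / real (card V)) ^ card F"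
proof -
  have N: "real (card V) > 0" using assms by (simp add: card_gt_0_iff)
  have "real (card {T \<in> spanning_trees V (all_edges V). F \<subseteq> T}) * real (card V) ^ 2 \<le>
      real (card V) ^ card (components V F) * 2 ^ card F"
    unfolding card_trees_containing_forest[OF assms]
    using prod_card_components_le[OF assms(1,3,4)] by (intro mult_left_mono) auto
  also have "\<dots> = real (card V) ^ card V * (2 / real (card V)) ^ card F"
  proof -
    have "real (card V) ^ card V = real (card V) ^ card (components V F) * real (card V) ^ card F"
      using card_forest[OF assms(1,3,4)] by (metis power_add add.commute)
    then show ?thesis using N by (simp add: power_divide)
  qed
  finally show ?thesis .
qed

section \<open>Trees weighted by their distance from a fixed tree\<close>

lemma sum_Pow_powers:
  fixes a b :: "'a :: comm_semiring_1"
  assumes "finite A"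
  shows "(\<Sum>F\<in>Pow A. a ^ card F * b ^ (card A - card F)) = (a + b) ^ card A"
proof -
  have "(a + b) ^ card A = (\<Sum>F\<in>Pow A. a ^ card F * b ^ card (A - F))"
    using prod_add[OF assms, of "\<lambda>_. a" "\<lambda>_. b"] by simp
  also have "\<dots> = (\<Sum>F\<in>Pow A. a ^ card F * b ^ (card A - card F))"
    using assms by (intro sum.cong refl) (auto simp: card_Diff_subset finite_subset)
  finally show ?thesis by simp
qed

text \<open>Writing 1 = (1 - q) + q for every edge of T \<inter> T' expands the weight of T' into a
  sum over forests F \<subseteq> T \<inter> T' whose terms \<open>g F\<close> depend on the size of
  F alone. After exchanging the sums, the trees above each F are counted, and the binomial theorem
  for subsets reassembles the bound.\<close>

lemma sum_trees_power_Diff_le: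
  assumes "finite V" "V \<noteq> {}" "T \<in> spanning_trees V (all_edges V)" "0 \<le> q" "q \<le> (1 :: real)"
  shows "(\<Sum>T'\<in>spanning_trees V (all_edges V). q ^ card (T' - T)) * real (card V) ^ 2 \<le>
    real (card V) ^ card V * (2 * (1 - q) / real (card V) + q) ^ (card V - 1)"
proof -
  let ?ST = "spanning_trees V (all_edges V)"
  define N where "N = card V"
  define g where "g F = (1 - q) ^ card F * q ^ (N - 1 - card F)" for F :: "nat set set"
  have T: "finite T" "card T = N - 1" "T \<subseteq> all_edges V" "forest T"
    using assms(3) finite_spanning_tree[OF assms(1,3)] card_spanning_tree[OF assms(1-3)]
    unfolding spanning_tree_iff[OF assms(1,2)] N_def by blast+
  have "q ^ card (T' - T) = (\<Sum>F | F \<in> Pow T \<and> F \<subseteq> T'. g F)" if "T' \<in> ?ST" for T'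
  proof -
    have T': "finite T'" "card T' = N - 1"
      using finite_spanning_tree[OF assms(1) that] card_spanning_tree[OF assms(1,2) that]
      unfolding N_def by blast+
    have le: "card (T \<inter> T') \<le> N - 1" using T by (metis card_mono inf_le1)
    have "(\<Sum>F | F \<in> Pow T \<and> F \<subseteq> T'. g F) =
        (\<Sum>F\<in>Pow (T \<inter> T'). q ^ card (T' - T) * ((1 - q) ^ card F * q ^ (card (T \<inter> T') - card F)))"
    proof (intro sum.cong)
      fix F assume "F \<in> Pow (T \<inter> T')"
      then have "card F \<le> card (T \<inter> T')" using T by (intro card_mono) auto
      moreover have "card (T' - T) = N - 1 - card (T \<inter> T')"
        using T T' by (metis card_Diff_subset_Int finite_Int inf_commute)
      ultimately have "N - 1 - card F = card (T' - T) + (card (T \<inter> T') - card F)"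
        using le by linarith
      then show "g F = q ^ card (T' - T) * ((1 - q) ^ card F * q ^ (card (T \<inter> T') - card F))"
        by (simp add: g_def power_add)
    qed auto
    also have "\<dots> = q ^ card (T' - T)"
      using T sum_Pow_powers[of "T \<inter> T'" "1 - q" q] by (simp add: sum_distrib_left[symmetric])
    finally show ?thesis by simp
  qed
  then have "(\<Sum>T'\<in>?ST. q ^ card (T' - T)) = (\<Sum>T'\<in>?ST. \<Sum>F | F \<in> Pow T \<and> F \<subseteq> T'. g F)"
    by (intro sum.cong) auto
  also have "\<dots> = (\<Sum>F\<in>Pow T. \<Sum>T' | T' \<in> ?ST \<and> F \<subseteq> T'. g F)"
    using T finite_spanning_trees[OF assms(1)] by (intro sum.swap_restrict) auto
  finally have "(\<Sum>T'\<in>?ST. q ^ card (T' - T)) * real N ^ 2 =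
      (\<Sum>F\<in>Pow T. g F * (real (card {T' \<in> ?ST. F \<subseteq> T'}) * real N ^ 2))"
    by (simp add: sum_distrib_left mult_ac)
  also have "\<dots> \<le> (\<Sum>F\<in>Pow T. g F * (real N ^ N * (2 / real N) ^ card F))"
  proof (intro sum_mono mult_left_mono)
    fix F assume "F \<in> Pow T"
    then show "real (card {T' \<in> ?ST. F \<subseteq> T'}) * real N ^ 2 \<le> real N ^ N * (2 / real N) ^ card F"
      using card_trees_containing_forest_le[OF assms(1,2), of F] T forest_subset by (auto simp: N_def)
  qed (use assms in \<open>auto simp: g_def\<close>)
  also have "\<dots> = real N ^ N * (\<Sum>F\<in>Pow T. (2 * (1 - q) / real N) ^ card F * q ^ (card T - card F))"
    unfolding sum_distrib_left
  proof (intro sum.cong refl)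
    fix F :: "nat set set"
    have "(2 * (1 - q) / real N) ^ card F = (1 - q) ^ card F * (2 / real N) ^ card F"
      by (simp add: power_mult_distrib[symmetric] mult.commute)
    then show "g F * (real N ^ N * (2 / real N) ^ card F) =
        real N ^ N * ((2 * (1 - q) / real N) ^ card F * q ^ (card T - card F))"
      by (simp add: g_def T)
  qed
  also have "\<dots> = real N ^ N * (2 * (1 - q) / real N + q) ^ (N - 1)"
    using sum_Pow_powers[OF T(1), of "2 * (1 - q) / real N" q] by (simp only: T(2))
  finally show ?thesis by (simp add: N_def)
qed

subsection \<open>Random graphs with a given number of edges\<close>

lemma card_supersets_of_card:
  assumes "finite U" "A \<subseteq> U" "card A \<le> m"
  shows "card {G. G \<subseteq> U \<and> card G = m \<and> A \<subseteq> G} = (card U - card A) choose (m - card A)"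
proof -
  have A: "finite A" using assms finite_subset by blast
  have "bij_betw (\<lambda>G. G - A) {G. G \<subseteq> U \<and> card G = m \<and> A \<subseteq> G}
      {B. B \<subseteq> U - A \<and> card B = m - card A}"
  proof (rule bij_betw_byWitness[where f' = "\<lambda>B. B \<union> A"])
    show "(\<lambda>G. G - A) ` {G. G \<subseteq> U \<and> card G = m \<and> A \<subseteq> G}
        \<subseteq> {B. B \<subseteq> U - A \<and> card B = m - card A}"
      using A by (auto simp: card_Diff_subset)
    show "(\<lambda>B. B \<union> A) ` {B. B \<subseteq> U - A \<and> card B = m - card A}
        \<subseteq> {G. G \<subseteq> U \<and> card G = m \<and> A \<subseteq> G}"
    proof clarify
      fix B assume B: "B \<subseteq> U - A" "card B = m - card A"
      then have "finite B" "B \<inter> A = {}" using assms(1) finite_subset by blast+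
      then show "B \<union> A \<subseteq> U \<and> card (B \<union> A) = m \<and> A \<subseteq> B \<union> A"
        using B A assms by (auto simp: card_Un_disjoint)
    qed
  qed auto
  then have "card {G. G \<subseteq> U \<and> card G = m \<and> A \<subseteq> G} = card {B. B \<subseteq> U - A \<and> card B = m - card A}"
    by (rule bij_betw_same_card)
  also have "\<dots> = (card U - card A) choose (m - card A)"
    using n_subsets[of "U - A"] assms A by (simp add: card_Diff_subset)
  finally show ?thesis .
qed

section \<open>Ratios of binomial coefficients\<close>

lemma choose_diff_Suc:
  assumes "r < b" "b \<le> a"
  shows "real ((a - Suc r) choose (b - Suc r)) =
    real ((a - r) choose (b - r)) * ((real b - real r) / (real a - real r))"
proof -
  have "Suc (b - Suc r) * (Suc (a - Suc r) choose Suc (b - Suc r)) =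
      Suc (a - Suc r) * ((a - Suc r) choose (b - Suc r))"
    by (rule Suc_times_binomial)
  then have "(b - r) * ((a - r) choose (b - r)) = (a - r) * ((a - Suc r) choose (b - Suc r))"
    using assms by (simp add: Suc_diff_Suc del: binomial_Suc_Suc)
  then have "real (b - r) * real ((a - r) choose (b - r)) =
      real (a - r) * real ((a - Suc r) choose (b - Suc r))"
    by (metis of_nat_mult)
  then show ?thesis using assms by (simp add: of_nat_diff field_simps)
qed

lemma choose_diff_le:
  assumes "r \<le> b" "b \<le> a"
  shows "real ((a - r) choose (b - r)) \<le> real (a choose b) * (real b / real a) ^ r"
  using assms(1)
proof (induction r)
  case (Suc r)
  have "(real b - real r) / (real a - real r) \<le> real b / real a"
    using Suc.prems assms(2) mult_right_mono[of "real b" "real a" "real r"] by (simp add: field_simps)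
  then have "real ((a - r) choose (b - r)) * ((real b - real r) / (real a - real r)) \<le>
      (real (a choose b) * (real b / real a) ^ r) * (real b / real a)"
    using Suc assms(2) by (intro mult_mono) auto
  then show ?case using choose_diff_Suc[of r b a] Suc.prems assms by (simp add: mult_ac)
qed simp

lemma exp_minus_double_le:
  fixes x :: real
  assumes "0 \<le> x" "x \<le> 1 / 2"
  shows "exp (- (2 * x)) \<le> 1 - x"
proof -
  have "- (2 * x) \<le> - x - 2 * x\<^sup>2"
    using assms mult_left_mono[of x "1/2" x] by (simp add: power2_eq_square)
  also have "\<dots> \<le> ln (1 - x)" by (rule ln_one_minus_pos_lower_bound[OF assms])
  finally show ?thesis using assms by (simp add: ln_ge_iff)
qed

text \<open>The r-th ratio (b - r) / (a - r) is at least (b/a) (1 - r/b) >= (b/a) exp(-2r/b), where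
  \<open>2 * s \<le> b\<close> keeps r/b below 1/2. The exponents 2r/b for r < s add up to s (s - 1)
  / b.\<close>

lemma choose_diff_ge:
  assumes "2 * s \<le> b" "b \<le> a"
  shows "real ((a - s) choose (b - s)) \<ge>
    real (a choose b) * (real b / real a) ^ s * exp (- (real s * (real s - 1) / real b))"
  using assms(1)
proof (induction s)
  case (Suc s)
  have b: "real b > 0" "real a > 0" "real s < real b" "real b \<le> real a" using Suc.prems assms by auto
  have "exp (- (2 * (real s / real b))) \<le> 1 - real s / real b"
    using Suc.prems b by (intro exp_minus_double_le) (auto simp: field_simps)
  then have "real b / real a * exp (- (2 * (real s / real b))) \<le> real b / real a * (1 - real s / real b)"
    by (intro mult_left_mono) auto
  also have "\<dots> = (real b - real s) / real a" using b by (simp add: field_simps)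
  also have "\<dots> \<le> (real b - real s) / (real a - real s)"
    using b by (intro divide_left_mono) auto
  finally have f: "real b / real a * exp (- (2 * (real s / real b))) \<le> (real b - real s) / (real a - real s)" .
  have e: "exp (- (real (Suc s) * (real (Suc s) - 1) / real b)) =
      exp (- (real s * (real s - 1) / real b)) * exp (- (2 * (real s / real b)))"
    unfolding exp_add[symmetric] using b by (simp add: field_simps)
  have "real (a choose b) * (real b / real a) ^ Suc s * exp (- (real (Suc s) * (real (Suc s) - 1) / real b))
      = (real (a choose b) * (real b / real a) ^ s * exp (- (real s * (real s - 1) / real b))) *
        (real b / real a * exp (- (2 * (real s / real b))))"
    unfolding e by simp
  also have "\<dots> \<le> real ((a - s) choose (b - s)) * ((real b - real s) / (real a - real s))"
    using Suc f by (intro mult_mono) auto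
  also have "\<dots> = real ((a - Suc s) choose (b - Suc s))"
    using choose_diff_Suc[of s b a] Suc.prems assms by simp
  finally show ?case .
qed simp

text \<open>The line touching the convex function 1/b at b = 1/l. Linearity in b is the point: after
  multiplication by \<open>tau_k\<close> only sums over trees and over pairs of trees
  remain.\<close>

lemma inverse_ge_tangent:
  fixes b l :: real
  assumes "b > 0"
  shows "1 / b \<ge> 2 * l - l\<^sup>2 * b"
proof -
  have "0 \<le> (1 - l * b)\<^sup>2" by simp
  then have "(2 * l - l\<^sup>2 * b) * b \<le> 1" by (simp add: power2_eq_square algebra_simps)
  then show ?thesis using assms by (simp add: field_simps)
qed

lemma real_choose_two: "real (n choose 2) = real n * (real n - 1) / 2"
proof (cases n)
  case (Suc l)
  have "even (n * (n - 1))" using Suc by simp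
  then have "2 * (n choose 2) = n * (n - 1)" by (simp only: choose_two dvd_mult_div_cancel)
  then have "2 * real (n choose 2) = real n * real (n - 1)"
    by (metis of_nat_mult of_nat_numeral)
  then show ?thesis using Suc by simp
qed simp

lemma split_prob_ge:
  assumes N: "3 \<le> N" "2 * N \<le> m" "m \<le> N choose 2"
  shows "split_prob k N m \<ge>
    real (card {T \<in> spanning_trees {..<N} (all_edges {..<N}). k_splittable k {..<N} T}) *
    real N ^ 2 / real N ^ N * exp (- 2 / (real m / real (N choose 2)))"
proof -
  define V where "V = {..<N}"
  define U where "U = all_edges V"
  define M where "M = N choose 2"
  define ST where "ST = spanning_trees V U"
  define SK where "SK = {T \<in> ST. k_splittable k V T}"
  define \<G> where "\<G> = {G. G \<subseteq> U \<and> card G = m}"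
  \<comment> \<open>For a planted tree, \<open>s\<close> is its number of edges, \<open>D\<close>
    the number of m-edge graphs containing it and \<open>q\<close> the density left on the other
    pairs. The tangent point \<open>1 / l\<close> is the bound N^(N-2) p^s for the planted
    mean.\<close>
  define s where "s = N - 1"
  define D where "D = real ((M - s) choose (m - s))"
  define p where "p = real m / real M"
  define q where "q = real (m - s) / real (M - s)"
  define l where "l = real N ^ 2 / (real N ^ N * p ^ s)"
  have V: "finite V" "V \<noteq> {}" "card V = N" using N by (auto simp: V_def lessThan_empty_iff bot_nat_def)
  have U: "finite U" "card U = M" using V by (auto simp: U_def finite_all_edges card_all_edges M_def)
  have fin: "finite ST" "finite SK" "finite \<G>"
    using finite_spanning_trees[OF V(1)] U by (auto simp: ST_def SK_def \<G>_def U_def)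
  have ST: "T \<subseteq> U" "finite T" "card T = s" if "T \<in> ST" for T
    using that card_spanning_tree[OF V(1,2)] finite_spanning_tree[OF V(1)]
    by (auto simp: ST_def s_def V U_def spanning_trees_def)
  have M: "real M = real N * (real N - 1) / 2"
    by (simp add: M_def real_choose_two)
  have sm: "2 * s \<le> m" "m \<le> M" "s < m" using N by (auto simp: s_def M_def)
  have q: "0 \<le> q" "q \<le> 1" using sm by (auto simp: q_def)
  have p0: "p > 0" using sm by (auto simp: p_def)
  have l0: "l > 0" using p0 N by (simp add: l_def)
  \<comment> \<open>Here M - s = (N - 1)(N - 2) / 2, so q (N - 2) = 2 (m - s) / (N - 1). Adding 2
    turns m - s into m, and division by N gives p.\<close>
  have pq: "2 * (1 - q) / real N + q = p"
  proof -
    define x where "x = real N"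
    have x: "x > 2" using N by (simp add: x_def)
    have "real (M - s) = x * (x - 1) / 2 - (x - 1)" "real (m - s) = real m - (x - 1)"
      using sm M N by (auto simp: x_def s_def of_nat_diff)
    then have Ms: "real (M - s) = (x - 1) * (x - 2) / 2" "real (m - s) = real m - (x - 1)"
      by (auto simp: field_simps)
    have "2 * (1 - q) / x + q = (2 + q * (x - 2)) / x" using x by (simp add: field_simps)
    also have "q * (x - 2) = 2 * (real m - (x - 1)) / (x - 1)"
      using x by (simp add: q_def Ms)
    also have "(2 + \<dots>) / x = p"
      using x by (simp add: p_def M x_def[symmetric] field_simps)
    finally show ?thesis by (simp add: x_def)
  qed
  have tau: "tau N G = card {T \<in> ST. T \<subseteq> G}" "tau_k k N G = card {T \<in> SK. T \<subseteq> G}" if "G \<in> \<G>" for G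
    using that by (auto simp: tau_def tau_k_def ST_def SK_def \<G>_def spanning_trees_def U_def V_def
        intro!: arg_cong[of _ _ card])
  \<comment> \<open>The quotient is 0 when \<open>tau\<close> is 0; the tangent bound then needs its
    left side to vanish too.\<close>
  have tau0: "tau_k k N G = 0" if "G \<in> \<G>" "tau N G = 0" for G
    using that fin by (auto simp: tau SK_def)
  have sup: "card {G \<in> \<G>. A \<subseteq> G} = (M - card A) choose (m - card A)" if "A \<subseteq> U" "card A \<le> m" for A
    using card_supersets_of_card[OF U(1) that] U by (simp add: \<G>_def conj_ac)

  have first: "(\<Sum>G\<in>\<G>. real (tau_k k N G)) = real (card SK) * D"
  proof -
    have "(\<Sum>G\<in>\<G>. real (tau_k k N G)) = (\<Sum>G\<in>\<G>. \<Sum>T | T \<in> SK \<and> T \<subseteq> G. 1)"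
      by (intro sum.cong) (auto simp: tau)
    also have "\<dots> = (\<Sum>T\<in>SK. \<Sum>G | G \<in> \<G> \<and> T \<subseteq> G. 1)"
      using fin by (intro sum.swap_restrict) auto
    also have "\<dots> = (\<Sum>T\<in>SK. D)"
      using ST sup sm by (intro sum.cong) (auto simp: SK_def D_def)
    finally show ?thesis by simp
  qed
  have second: "(\<Sum>G\<in>\<G>. real (tau_k k N G) * real (tau N G)) \<le> real (card SK) * D / l"
  proof -
    have "(\<Sum>G\<in>\<G>. real (tau_k k N G) * real (tau N G)) =
        (\<Sum>G\<in>\<G>. \<Sum>P | P \<in> SK \<times> ST \<and> fst P \<union> snd P \<subseteq> G. 1)"
    proof (intro sum.cong refl)
      fix G assume "G \<in> \<G>"
      have "{P. P \<in> SK \<times> ST \<and> fst P \<union> snd P \<subseteq> G} = {T \<in> SK. T \<subseteq> G} \<times> {T \<in> ST. T \<subseteq> G}" by auto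
      then show "real (tau_k k N G) * real (tau N G) = (\<Sum>P | P \<in> SK \<times> ST \<and> fst P \<union> snd P \<subseteq> G. 1)"
        using \<open>G \<in> \<G>\<close> by (simp add: tau card_cartesian_product)
    qed
    also have "\<dots> = (\<Sum>P\<in>SK \<times> ST. \<Sum>G | G \<in> \<G> \<and> fst P \<union> snd P \<subseteq> G. 1)"
      using fin by (intro sum.swap_restrict) auto
    also have "\<dots> = (\<Sum>T\<in>SK. \<Sum>T'\<in>ST. real (card {G \<in> \<G>. T \<union> T' \<subseteq> G}))"
      by (simp add: sum.cartesian_product case_prod_beta)
    also have "\<dots> \<le> (\<Sum>T\<in>SK. D / l)"
    proof (intro sum_mono)
      fix T assume "T \<in> SK"
      then have T: "T \<in> ST" by (simp add: SK_def)
      have "(\<Sum>T'\<in>ST. real (card {G \<in> \<G>. T \<union> T' \<subseteq> G})) \<le> (\<Sum>T'\<in>ST. D * q ^ card (T' - T))"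
      proof (intro sum_mono)
        fix T' assume T': "T' \<in> ST"
        define r where "r = card (T' - T)"
        have r: "r \<le> s" using ST[OF T'] unfolding r_def by (metis Diff_subset card_mono)
        have "T \<union> T' = T \<union> (T' - T)" by auto
        then have "card (T \<union> T') = s + r"
          using ST[OF T] ST[OF T'] by (simp only: r_def) (subst card_Un_disjoint, auto)
        then have "card {G \<in> \<G>. T \<union> T' \<subseteq> G} = (M - (s + r)) choose (m - (s + r))"
          using sup[of "T \<union> T'"] ST(1)[OF T] ST(1)[OF T'] r sm by simp
        also have "\<dots> = (M - s - r) choose (m - s - r)" by simp
        finally show "real (card {G \<in> \<G>. T \<union> T' \<subseteq> G}) \<le> D * q ^ card (T' - T)"
          using choose_diff_le[of r "m - s" "M - s"] r sm by (simp add: D_def q_def r_def)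
      qed
      also have "\<dots> = D * (\<Sum>T'\<in>ST. q ^ card (T' - T))"
        by (simp add: sum_distrib_left)
      also have "\<dots> \<le> D * (1 / l)"
      proof (intro mult_left_mono)
        have "(\<Sum>T'\<in>ST. q ^ card (T' - T)) * real N ^ 2 \<le> real N ^ N * p ^ s"
          using sum_trees_power_Diff_le[OF V(1,2) _ q, of T] T
          by (simp only: ST_def U_def V(3) pq s_def)
        then show "(\<Sum>T'\<in>ST. q ^ card (T' - T)) \<le> 1 / l"
          using N by (simp add: l_def field_simps)
      qed (simp add: D_def)
      finally show "(\<Sum>T'\<in>ST. real (card {G \<in> \<G>. T \<union> T' \<subseteq> G})) \<le> D / l" by simp
    qed
    finally show ?thesis by simp
  qed
  \<comment> \<open>At this tangent point the quadratic loss is at most half of the linear gain 2 l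
    |SK| D, which leaves l |SK| D.\<close>
  have "real (card SK) * D * l = 2 * l * (real (card SK) * D) - l\<^sup>2 * (real (card SK) * D / l)"
    using l0 by (simp add: power2_eq_square field_simps)
  also have "\<dots> \<le> 2 * l * (\<Sum>G\<in>\<G>. real (tau_k k N G)) -
      l\<^sup>2 * (\<Sum>G\<in>\<G>. real (tau_k k N G) * real (tau N G))"
    unfolding first using mult_left_mono[OF second, of "l\<^sup>2"] by simp
  also have "\<dots> = (\<Sum>G\<in>\<G>. real (tau_k k N G) * (2 * l - l\<^sup>2 * real (tau N G)))"
    by (simp add: sum_distrib_left sum_subtractf algebra_simps)
  also have "\<dots> \<le> (\<Sum>G\<in>\<G>. real (tau_k k N G) / real (tau N G))"
  proof (intro sum_mono)
    fix G assume G: "G \<in> \<G>"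
    show "real (tau_k k N G) * (2 * l - l\<^sup>2 * real (tau N G)) \<le> real (tau_k k N G) / real (tau N G)"
    proof (cases "tau N G = 0")
      case True
      then show ?thesis using tau0[OF G] by simp
    next
      case False
      then show ?thesis
        using mult_left_mono[OF inverse_ge_tangent[of "real (tau N G)" l], of "real (tau_k k N G)"] by simp
    qed
  qed
  \<comment> \<open>Every subgraph of a disconnected graph is disconnected, so such a graph has no
    spanning tree and its quotient is 0.\<close>
  also have "\<dots> = (\<Sum>G\<in>conn_graphs N m. real (tau_k k N G) / real (tau N G))"
  proof (rule sum.mono_neutral_right)
    show "\<forall>G\<in>\<G> - conn_graphs N m. real (tau_k k N G) / real (tau N G) = 0"
    proof
      fix G assume G: "G \<in> \<G> - conn_graphs N m"
      then have "\<not> connected_graph V G"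
        by (auto simp: conn_graphs_def \<G>_def U_def V_def)
      then have "\<not> connected_graph V T" if "T \<subseteq> G" for T
        using reach_mono[OF that] unfolding connected_graph_def by blast
      then have "spanning_trees V G = {}"
        by (auto simp: spanning_trees_def)
      then show "real (tau_k k N G) / real (tau N G) = 0"
        by (simp add: tau_def V_def)
    qed
  qed (use fin in \<open>auto simp: conn_graphs_def \<G>_def U_def V_def\<close>)
  finally have sum_ge: "(\<Sum>G\<in>conn_graphs N m. real (tau_k k N G) / real (tau N G)) \<ge> real (card SK) * D * l" .
  have conn_le: "card (conn_graphs N m) \<le> M choose m"
  proof -
    have "card (conn_graphs N m) \<le> card \<G>"
      using fin by (intro card_mono) (auto simp: conn_graphs_def \<G>_def U_def V_def)
    then show ?thesis using n_subsets[OF U(1), of m] U by (simp add: \<G>_def)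
  qed
  have Mm: "real (M choose m) > 0" using sm by (simp add: binomial_eq_0_iff)
  have "real (card SK) * real N ^ 2 / real N ^ N * exp (- 2 / p) =
      real (card SK) * l * (real (M choose m) * p ^ s * exp (- 2 / p)) / real (M choose m)"
    using p0 N Mm by (simp add: l_def)
  also have "\<dots> \<le> real (card SK) * l * D / real (M choose m)"
  proof (intro divide_right_mono mult_left_mono)
    \<comment> \<open>Source of the 2 in exp(-2/p): (N - 1)(N - 2) <= N (N - 1) = 2 M, so the
      exponent s (s - 1) / m of \<open>choose_diff_ge\<close> is at most 2 M / m = 2 / p.\<close>
    have "real s * (real s - 1) \<le> 2 * real M"
      using N by (simp add: M s_def of_nat_diff algebra_simps)
    then have "- 2 / p \<le> - (real s * (real s - 1) / real m)"
      using divide_right_mono[of "real s * (real s - 1)" "2 * real M" "real m"] by (simp add: p_def)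
    then have "real (M choose m) * p ^ s * exp (- 2 / p) \<le>
        real (M choose m) * p ^ s * exp (- (real s * (real s - 1) / real m))"
      using p0 by (intro mult_left_mono) auto
    also have "\<dots> \<le> D"
      using choose_diff_ge[of s m M] sm by (simp add: p_def D_def)
    finally show "real (M choose m) * p ^ s * exp (- 2 / p) \<le> D" .
  qed (use l0 in auto)
  also have "\<dots> \<le> (\<Sum>G\<in>conn_graphs N m. real (tau_k k N G) / real (tau N G)) / real (M choose m)"
    using sum_ge by (intro divide_right_mono) (auto simp: mult_ac)
  also have "\<dots> \<le> split_prob k N m"
  proof (cases "conn_graphs N m = {}")
    \<comment> \<open>With no connected graph the sum is empty and both sides are 0.\<close>
    case True
    then show ?thesis by (simp add: split_prob_def)
  next
    case False
    moreover have "finite (conn_graphs N m)"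
      using fin(3) by (rule finite_subset[rotated]) (auto simp: conn_graphs_def \<G>_def U_def V_def)
    ultimately have "card (conn_graphs N m) > 0" by (simp add: card_gt_0_iff)
    then show ?thesis
      unfolding split_prob_def using conn_le
      by (intro divide_left_mono sum_nonneg mult_pos_pos Mm) auto
  qed
  finally show ?thesis
    by (simp add: SK_def ST_def U_def V_def p_def M_def)
qed

subsection \<open>Equal splits\<close>

text \<open>A set that no edge leaves is a disjoint union of components, all of size n.\<close>

lemma dvd_card_closed_set:
  assumes "finite V" "A \<subseteq> V" "\<And>C. C \<in> components V E \<Longrightarrow> card C = n"
    and closed: "\<And>x y. {x, y} \<in> E \<Longrightarrow> x \<in> A \<Longrightarrow> y \<in> A"
  shows "n dvd card A"
proof -
  let ?K = "{C \<in> components V E. C \<subseteq> A}"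
  have "comp_of V E x \<subseteq> A" if "x \<in> A" for x
    using reach_closed[of x _ E A] that closed by (auto simp: comp_of_def)
  then have A: "A = \<Union> ?K"
    using assms(2) comp_of_self[of _ V E] by (fastforce simp: components_eq)
  have "card (\<Union> ?K) = sum card ?K"
    using components_disjoint[of V E] finite_component[OF assms(1), of _ E]
    by (intro card_Union_disjoint) (auto simp: pairwise_def)
  then have "card A = sum card ?K" using A by simp
  also have "\<dots> = (\<Sum>C\<in>?K. n)" using assms(3) by (intro sum.cong) auto
  finally show ?thesis by simp
qed

text \<open>If an edge e was cut in one equal split but not in the other, then one side of T - e would be a
  union of parts of the first split, yet meet the part of the second split around e in a nonempty
  proper subset.\<close>

lemma equal_split_subset:
  assumes "finite V" "T \<subseteq> all_edges V" "forest T" "S \<subseteq> T"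
    and S: "\<And>C. C \<in> components V (T - S) \<Longrightarrow> card C = n"
    and S': "\<And>C. C \<in> components V (T - S') \<Longrightarrow> card C = n"
  shows "S \<subseteq> S'"
proof
  fix e assume "e \<in> S"
  then have "e \<in> T" "e \<in> all_edges V" using assms by auto
  then obtain u v where e: "e = {u, v}" "u \<in> V" "v \<in> V" by (blast elim: all_edgesE)
  define A where "A = comp_of V (T - {e}) u"
  define B where "B = comp_of V (T - S') u"
  have AB: "A \<subseteq> V" "B \<subseteq> V" "finite A" "finite B"
    using assms(1) by (auto simp: A_def B_def comp_of_def)
  have comp_closed: "y \<in> comp_of V E x"
    if "{z, y} \<in> E" "E \<subseteq> T" "z \<in> comp_of V E x" for E x y z
    using that assms(2) reach_edge[of z y E]
    by (auto simp: comp_of_def all_edges_def intro: rtrancl_trans)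
  show "e \<in> S'"
  proof (rule ccontr)
    assume "e \<notin> S'"
    have A: "y \<in> A" if "{x, y} \<in> T - {e}" "x \<in> A" for x y
      using comp_closed[of x y "T - {e}" u] that by (auto simp: A_def)
    have B: "y \<in> B" if "{x, y} \<in> T - S'" "x \<in> B" for x y
      using comp_closed[of x y "T - S'" u] that by (auto simp: B_def)
    have "v \<notin> A" using assms(3) \<open>e \<in> T\<close> e by (auto simp: forest_def A_def comp_of_def)
    have "u \<in> A" "u \<in> B" using e by (auto simp: A_def B_def comp_of_self)
    then have "v \<in> B" using B[of u v] \<open>e \<in> T\<close> \<open>e \<notin> S'\<close> e by auto
    have "n dvd card A"
    proof (rule dvd_card_closed_set[OF assms(1) AB(1) S])
      show "y \<in> A" if "{x, y} \<in> T - S" "x \<in> A" for x y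
        using A[of x y] that \<open>e \<in> S\<close> by blast
    qed
    \<comment> \<open>The only edge of T leaving \<open>A\<close> is e, and both its ends lie in
      \<open>B\<close>. Hence A \<union> B is a union of parts of the second split, and
      inclusion-exclusion makes the size of A \<inter> B divisible by n.\<close>
    moreover have "n dvd card (A \<union> B)"
    proof (rule dvd_card_closed_set[OF assms(1) _ S'])
      show "y \<in> A \<union> B" if "{x, y} \<in> T - S'" "x \<in> A \<union> B" for x y
      proof (cases "{x, y} = e")
        case True
        then show ?thesis using \<open>u \<in> B\<close> \<open>v \<in> B\<close> e by (auto simp: doubleton_eq_iff)
      next
        case False
        then show ?thesis using A[of x y] B[of x y] that by blast
      qed
    qed (use AB in auto)
    moreover have B_n: "card B = n"
      using S' e by (auto simp: B_def components_eq)
    moreover have "card A + card B = card (A \<union> B) + card (A \<inter> B)"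
      using AB by (intro card_Un_Int)
    ultimately have "n dvd card (A \<inter> B)"
      by (metis dvd_add dvd_add_right_iff dvd_refl)
    moreover have "card (A \<inter> B) > 0" using AB \<open>u \<in> A\<close> \<open>u \<in> B\<close> by (auto simp: card_gt_0_iff)
    moreover have "card (A \<inter> B) < n"
      using B_n AB \<open>v \<in> B\<close> \<open>v \<notin> A\<close> psubset_card_mono[of B "A \<inter> B"] by blast
    ultimately show False using nat_dvd_not_less by blast
  qed
qed

section \<open>Forests glued from trees on disjoint blocks\<close>

context
  fixes I :: "'i set" and B :: "'i \<Rightarrow> nat set" and t :: "'i \<Rightarrow> nat set set" and V :: "nat set"
  assumes disj: "disjoint_family_on B I" and V: "V = (\<Union>i\<in>I. B i)"
    and tree: "\<And>i. i \<in> I \<Longrightarrow> t i \<in> spanning_trees (B i) (all_edges (B i))"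
begin

lemma union_of_trees_edge:
  assumes "i \<in> I" "x \<in> B i" "{x, y} \<in> (\<Union>i\<in>I. t i)"
  shows "{x, y} \<in> t i" "y \<in> B i"
proof -
  obtain j where j: "j \<in> I" "{x, y} \<in> t j" using assms by blast
  then have "{x, y} \<in> all_edges (B j)"
    using tree[of j] by (auto simp: spanning_trees_def)
  then have "x \<in> B j" "y \<in> B j" by (auto simp: all_edges_def)
  then have "j = i" using disj assms j by (auto simp: disjoint_family_on_def)
  then show "{x, y} \<in> t i" "y \<in> B i" using j \<open>y \<in> B j\<close> by auto
qed

lemma union_of_trees_all_edges: "(\<Union>i\<in>I. t i) \<subseteq> all_edges V"
proof -
  have "t i \<subseteq> all_edges (B i)" if "i \<in> I" for i
    using tree[OF that] by (simp add: spanning_trees_def)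
  then show ?thesis unfolding V all_edges_def by blast
qed

text \<open>Recovers each tree from the glued forest and its block; needed for injectivity when such
  families are counted.\<close>

lemma union_of_trees_Int:
  assumes "i \<in> I"
  shows "(\<Union>i\<in>I. t i) \<inter> all_edges (B i) = t i"
proof
  show "(\<Union>i\<in>I. t i) \<inter> all_edges (B i) \<subseteq> t i"
  proof
    fix e assume e: "e \<in> (\<Union>i\<in>I. t i) \<inter> all_edges (B i)"
    then have "e \<in> all_edges (B i)" by simp
    then obtain x y where "e = {x, y}" "x \<in> B i" by (rule all_edgesE)
    then show "e \<in> t i" using union_of_trees_edge(1)[OF assms, of x y] e by simp
  qed
qed (use assms tree[OF assms] in \<open>auto simp: spanning_trees_def\<close>)

lemma comp_of_union_of_trees:
  assumes "i \<in> I" "x \<in> B i"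
  shows "comp_of V (\<Union>i\<in>I. t i) x = B i"
proof (intro equalityI subsetI)
  fix y assume "y \<in> comp_of V (\<Union>i\<in>I. t i) x"
  then have "(x, y) \<in> (adj (\<Union>i\<in>I. t i))\<^sup>*" by (simp add: comp_of_def)
  then show "y \<in> B i"
    using assms(2) union_of_trees_edge(2)[OF assms(1)] by (rule reach_closed)
next
  fix y assume "y \<in> B i"
  then have "(x, y) \<in> (adj (t i))\<^sup>*"
    using tree[OF assms(1)] assms by (auto simp: spanning_trees_def connected_graph_def)
  then have "(x, y) \<in> (adj (\<Union>i\<in>I. t i))\<^sup>*" using assms(1) reach_mono[of "t i" "\<Union>i\<in>I. t i"] by blast
  then show "y \<in> comp_of V (\<Union>i\<in>I. t i) x"
    using \<open>y \<in> B i\<close> assms(1) by (auto simp: comp_of_def V)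
qed

lemma components_union_of_trees:
  assumes "\<And>i. i \<in> I \<Longrightarrow> B i \<noteq> {}"
  shows "components V (\<Union>i\<in>I. t i) = B ` I"
proof (intro equalityI subsetI)
  fix C assume "C \<in> components V (\<Union>i\<in>I. t i)"
  then obtain x where "x \<in> V" "C = comp_of V (\<Union>i\<in>I. t i) x" by (auto simp: components_eq)
  then show "C \<in> B ` I" using comp_of_union_of_trees V by blast
next
  fix C assume "C \<in> B ` I"
  then obtain i x where "i \<in> I" "x \<in> B i" "C = B i" using assms by blast
  then show "C \<in> components V (\<Union>i\<in>I. t i)"
    using comp_of_union_of_trees[of i x] V by (auto simp: components_eq)
qed

text \<open>A detour around an edge of \<open>t i\<close> starts in the block \<open>B i\<close> and
  can never leave it, so it would be a detour inside the tree \<open>t i\<close>.\<close>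

lemma forest_union_of_trees: "forest (\<Union>i\<in>I. t i)"
  unfolding forest_def
proof (intro allI impI notI)
  fix u v
  assume uv: "{u, v} \<in> (\<Union>i\<in>I. t i)" and r: "(u, v) \<in> (adj ((\<Union>i\<in>I. t i) - {{u, v}}))\<^sup>*"
  then obtain i where i: "i \<in> I" "{u, v} \<in> t i" by blast
  have "t i \<subseteq> all_edges (B i)" "\<not> has_cycle (t i)"
    using tree[OF i(1)] by (auto simp: spanning_trees_def)
  then have ti: "forest (t i)" "u \<in> B i"
    using i has_cycle_iff[of "t i" "B i"] by (auto simp: all_edges_def)
  have "v \<in> {y \<in> B i. (u, y) \<in> (adj (t i - {{u, v}}))\<^sup>*}"
    using r
  proof (rule reach_closed)
    fix x y
    assume xy: "{x, y} \<in> (\<Union>i\<in>I. t i) - {{u, v}}" "x \<in> {y \<in> B i. (u, y) \<in> (adj (t i - {{u, v}}))\<^sup>*}"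
    then have "{x, y} \<in> t i - {{u, v}}" "y \<in> B i"
      using union_of_trees_edge[OF i(1), of x y] by auto
    then show "y \<in> {y \<in> B i. (u, y) \<in> (adj (t i - {{u, v}}))\<^sup>*}"
      using xy reach_edge[of x y "t i - {{u, v}}"] by (auto intro: rtrancl_trans)
  qed (use ti in simp)
  then show False using ti i by (auto simp: forest_def)
qed

end

subsection \<open>Counting splittable trees\<close>

text \<open>A colouring of the vertices is encoded as the list of their colours; this is one colour
  class.\<close>

definition fibre :: "nat list \<Rightarrow> nat \<Rightarrow> nat set" where
  "fibre xs i = {v. v < length xs \<and> xs ! v = i}"

text \<open>Colourings that use each of the k colours n times, given as permutations of a multiset
  so that their number is a multinomial coefficient.\<close>

definition balanced_colourings :: "nat \<Rightarrow> nat \<Rightarrow> nat list set" where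
  "balanced_colourings k n = permutations_of_multiset (\<Sum>i<k. replicate_mset n i)"

lemma count_balanced:
  fixes j k n :: nat
  shows "count (\<Sum>i<k. replicate_mset n i) j = (if j < k then n else 0)"
  proof -
  have "count (\<Sum>i<k. replicate_mset n i) j = (\<Sum>i<k. if j = i then n else 0)"
    by (simp add: count_sum)
  also have "\<dots> = (if j \<in> {..<k} then n else 0)" by (rule sum.delta') simp
  finally show ?thesis by simp
qed

lemma card_balanced_colourings:
  assumes "n > 0"
  shows "card (balanced_colourings k n) * fact n ^ k = fact (k * n)"
proof -
  have "set_mset (\<Sum>i<k. replicate_mset n i) = {..<k}"
    using assms by (auto simp: set_mset_def count_balanced)
  then show ?thesis
    using card_permutations_of_multiset_aux[of "\<Sum>i<k. replicate_mset n i"]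
    by (simp add: balanced_colourings_def count_balanced size_multiset_sum)
qed

lemma balanced_colouringsD:
  assumes "xs \<in> balanced_colourings k n"
  shows "length xs = k * n" "i < k \<Longrightarrow> card (fibre xs i) = n" "n > 0 \<Longrightarrow> v < k * n \<Longrightarrow> xs ! v < k"
proof -
  have xs: "mset xs = (\<Sum>i<k. replicate_mset n i)"
    using assms by (simp add: balanced_colourings_def permutations_of_multiset_def)
  have "size (mset xs) = k * n" unfolding xs by (simp add: size_multiset_sum)
  then show len: "length xs = k * n" by simp
  show "card (fibre xs i) = n" if "i < k"
  proof -
    have "n = count (mset xs) i" using that by (simp add: xs count_balanced)
    then show ?thesis by (simp add: fibre_def count_mset count_list_eq_length_filter length_filter_conv_card eq_commute)
  qed
  show "xs ! v < k" if "n > 0" "v < k * n"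
  proof -
    have "count (mset xs) (xs ! v) > 0"
      using that len by (simp add: count_mset_gt_0)
    then show ?thesis by (simp add: xs count_balanced split: if_splits)
  qed
qed

text \<open>Double counting of pairs (q, T), where q in \<open>P\<close> is a balanced colouring
  with a tree in each class and T contains the forest \<open>F q\<close>. Each q has N^k n^k / N^2
  trees above it, all splittable, and each T occurs at most k^k times. This k^k cancels against N^k
  = k^k n^k.\<close>

lemma card_splittable_trees_ge:
  assumes "k > 0" "n > 0"
  shows "real (card {T \<in> spanning_trees {..<k * n} (all_edges {..<k * n}). k_splittable k {..<k * n} T}) *
      real (k * n) ^ 2 / real (k * n) ^ (k * n) \<ge> fact (k * n) / (fact n ^ k * real k ^ (k * n))"
proof -
  define N where "N = k * n"
  define V where "V = {..<N}"
  define ST where "ST = spanning_trees V (all_edges V)"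
  define SK where "SK = {T \<in> ST. k_splittable k V T}"
  define trees where "trees xs = PiE {..<k} (\<lambda>i. spanning_trees (fibre xs i) (all_edges (fibre xs i)))" for xs
  define P where "P = (SIGMA xs : balanced_colourings k n. trees xs)"
  define F where "F = (\<lambda>(xs :: nat list, t :: nat \<Rightarrow> nat set set). \<Union>i<k. t i)"
  have N: "N > 0" using assms by (simp add: N_def)
  have V: "finite V" "V \<noteq> {}" "card V = N" using N by (auto simp: V_def lessThan_empty_iff bot_nat_def)
  have finST: "finite ST" "finite SK" using finite_spanning_trees[OF V(1)] by (auto simp: ST_def SK_def)
  note col = balanced_colouringsD
  have fib: "finite (fibre xs i)" "card (fibre xs i) = n" "fibre xs i \<noteq> {}"
    if "xs \<in> balanced_colourings k n" "i < k" for xs i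
    using that col(2)[OF that] assms by (auto simp: card_gt_0_iff intro: card_ge_0_finite)
  have finP: "finite P"
    unfolding P_def trees_def balanced_colourings_def
    by (intro finite_SigmaI finite_PiE finite_permutations_of_multiset finite_spanning_trees fib)
      (auto simp: balanced_colourings_def)
  have fam: "disjoint_family_on (fibre xs) {..<k}" "V = (\<Union>i<k. fibre xs i)"
    if "xs \<in> balanced_colourings k n" for xs
    using col(1,3)[OF that] assms by (auto simp: disjoint_family_on_def fibre_def V_def N_def)
  have tree: "t i \<in> spanning_trees (fibre xs i) (all_edges (fibre xs i))"
    if "t \<in> trees xs" "i \<in> {..<k}" for t xs i
    using that by (auto simp: trees_def)
  have F: "F (xs, t) \<subseteq> all_edges V" "forest (F (xs, t))" "components V (F (xs, t)) = fibre xs ` {..<k}"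
    "card (components V (F (xs, t))) = k"
    "\<And>C. C \<in> components V (F (xs, t)) \<Longrightarrow> card C = n"
    "\<And>i. i < k \<Longrightarrow> F (xs, t) \<inter> all_edges (fibre xs i) = t i"
    "\<And>i x. i < k \<Longrightarrow> x \<in> fibre xs i \<Longrightarrow> comp_of V (F (xs, t)) x = fibre xs i"
    if "(xs, t) \<in> P" for xs t
  proof -
    have xs: "xs \<in> balanced_colourings k n" and t: "t \<in> trees xs" using that by (auto simp: P_def)
    note fam = fam[OF xs] tree[OF t]
    have FU: "F (xs, t) = (\<Union>i<k. t i)" by (simp add: F_def)
    show "F (xs, t) \<subseteq> all_edges V" unfolding FU by (rule union_of_trees_all_edges[OF fam])
    show "forest (F (xs, t))" unfolding FU by (rule forest_union_of_trees[OF fam])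
    show c: "components V (F (xs, t)) = fibre xs ` {..<k}"
      unfolding FU by (rule components_union_of_trees[OF fam]) (use fib[OF xs] in auto)
    have "inj_on (fibre xs) {..<k}"
      using fib[OF xs] by (auto simp: inj_on_def fibre_def)
    then show "card (components V (F (xs, t))) = k" unfolding c by (simp add: card_image)
    show "card C = n" if "C \<in> components V (F (xs, t))" for C
      using that fib[OF xs] by (auto simp: c)
    show "F (xs, t) \<inter> all_edges (fibre xs i) = t i" if "i < k" for i
      unfolding FU by (rule union_of_trees_Int[OF fam]) (use that in auto)
    show "comp_of V (F (xs, t)) x = fibre xs i" if "i < k" "x \<in> fibre xs i" for i x
      unfolding FU by (rule comp_of_union_of_trees[OF fam]) (use that in auto)
  qed
  have split: "T \<in> SK" if "q \<in> P" "T \<in> ST" "F q \<subseteq> T" for q T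
  proof -
    obtain xs t where q: "q = (xs, t)" by (cases q)
    note Fq = F[of xs t, folded q, OF that(1)]
    have T: "finite T" "card T = N - 1"
      using that finite_spanning_tree[OF V(1)] card_spanning_tree[OF V(1,2)] V by (auto simp: ST_def)
    have "card (F q) + k = N" using card_forest[OF V(1) Fq(1,2)] Fq(4) V by simp
    then have "card (T - F q) = k - 1"
      using T that(3) by (simp add: card_Diff_subset finite_subset)
    moreover have "T - (T - F q) = F q" using that by blast
    ultimately have "k_splittable k V T"
      unfolding k_splittable_def using Fq by (intro exI[of _ "T - F q"]) auto
    then show ?thesis using that by (simp add: SK_def)
  qed
  have mult: "card {q \<in> P. F q \<subseteq> T} \<le> k ^ k" if T: "T \<in> SK" for T
  proof (cases "{q \<in> P. F q \<subseteq> T} = {}")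
    case False
    then obtain xs0 t0 where q0: "(xs0, t0) \<in> P" "F (xs0, t0) \<subseteq> T" by auto
    have xs0: "xs0 \<in> balanced_colourings k n" using q0 by (simp add: P_def)
    have T': "T \<subseteq> all_edges V" "forest T"
      using T V by (auto simp: SK_def ST_def spanning_tree_iff)
    \<comment> \<open>T - F q and T - F (xs0, t0) both cut T into parts of size n, so
      \<open>equal_split_subset\<close> in both directions identifies them.\<close>
    have Feq: "F q = F (xs0, t0)" if "q \<in> P" "F q \<subseteq> T" for q
    proof -
      obtain xs t where q: "q = (xs, t)" by (cases q)
      have "T - (T - F q) = F q" "T - (T - F (xs0, t0)) = F (xs0, t0)" using that q0 by blast+
      then have c: "card C = n" if "C \<in> components V (T - (T - F q)) \<or>
          C \<in> components V (T - (T - F (xs0, t0)))" for C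
        using that F(5)[OF q0(1), of C] F(5)[of xs t C, folded q, OF \<open>q \<in> P\<close>] by metis
      have "T - F q \<subseteq> T - F (xs0, t0)"
        by (rule equal_split_subset[OF V(1) T', of _ n]) (use c in auto)
      moreover have "T - F (xs0, t0) \<subseteq> T - F q"
        by (rule equal_split_subset[OF V(1) T', of _ n]) (use c in auto)
      ultimately have "T - F q = T - F (xs0, t0)" by (rule equalityI)
      then show ?thesis using that q0 by blast
    qed
    define r where "r i = (SOME v. v \<in> fibre xs0 i)" for i
    have r: "r i \<in> fibre xs0 i" if "i < k" for i
      unfolding r_def using fib(3)[OF xs0 that] by (simp add: some_in_eq)
    \<comment> \<open>The colour classes of xs and xs0 are the components of the same forest, so xs
      is constant on every class of xs0.\<close>
    have rep: "xs ! v = xs ! r (xs0 ! v)" if q: "(xs, t) \<in> P" "F (xs, t) \<subseteq> T" and v: "v < N" for xs t v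
    proof -
      have xs: "xs \<in> balanced_colourings k n" using q by (simp add: P_def)
      have len: "length xs = N" "length xs0 = N" using col(1)[OF xs] col(1)[OF xs0] by (auto simp: N_def)
      have j: "xs0 ! v < k" "xs ! v < k" using col(3)[OF xs0 assms(2)] col(3)[OF xs assms(2)] v by (auto simp: N_def)
      have "fibre xs (xs ! v) = fibre xs0 (xs0 ! v)"
        using F(7)[OF q(1) j(2), of v] F(7)[OF q0(1) j(1), of v] Feq[OF q] v len by (simp add: fibre_def)
      then have "r (xs0 ! v) \<in> fibre xs (xs ! v)" using r[OF j(1)] by simp
      then show ?thesis by (simp add: fibre_def)
    qed
    \<comment> \<open>Since T fixes the forest, only the colours of its k parts are free. They are
      read off at the representatives \<open>r i\<close>, which bounds the multiplicity by the
      number of maps from k parts to k colours.\<close>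
    let ?\<phi> = "\<lambda>q. \<lambda>i\<in>{..<k}. fst q ! r i"
    have "inj_on ?\<phi> {q \<in> P. F q \<subseteq> T}"
    proof (rule inj_onI, clarify)
      fix xs t ys s
      assume q: "(xs, t) \<in> P" "F (xs, t) \<subseteq> T" "(ys, s) \<in> P" "F (ys, s) \<subseteq> T"
        and eq: "?\<phi> (xs, t) = ?\<phi> (ys, s)"
      have cols: "xs \<in> balanced_colourings k n" "ys \<in> balanced_colourings k n" "t \<in> trees xs" "s \<in> trees ys"
        using q by (auto simp: P_def)
      have "xs ! v = ys ! v" if "v < N" for v
      proof -
        have "xs0 ! v < k" using col(3)[OF xs0 assms(2)] that by (simp add: N_def)
        then have "xs ! r (xs0 ! v) = ys ! r (xs0 ! v)"
          using fun_cong[OF eq, of "xs0 ! v"] by simp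
        then show ?thesis using rep[OF q(1,2) that] rep[OF q(3,4) that] by simp
      qed
      then have xy: "xs = ys"
        using col(1)[OF cols(1)] col(1)[OF cols(2)] by (auto intro: nth_equalityI simp: N_def)
      have "t i = s i" if "i < k" for i
        using F(6)[OF q(1) that] F(6)[OF q(3) that] Feq[OF q(1,2)] Feq[OF q(3,4)] xy by simp
      then have "t = s"
        using cols(3,4) unfolding trees_def xy by (auto intro: PiE_ext)
      with xy show "xs = ys \<and> t = s" by simp
    qed
    moreover have "?\<phi> ` {q \<in> P. F q \<subseteq> T} \<subseteq> PiE {..<k} (\<lambda>_. {..<k})"
    proof (rule image_subsetI, rule restrict_PiE_iff[THEN iffD2], rule ballI)
      fix q i assume q: "q \<in> {q \<in> P. F q \<subseteq> T}" and i: "i \<in> {..<k}"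
      then have "fst q \<in> balanced_colourings k n" by (auto simp: P_def)
      moreover have "r i < k * n" using r[of i] i col(1)[OF xs0] by (auto simp: fibre_def)
      ultimately show "fst q ! r i \<in> {..<k}" using col(3) assms by auto
    qed
    ultimately have "card {q \<in> P. F q \<subseteq> T} \<le> card (PiE {..<k} (\<lambda>_. {..<k}))"
      by (intro card_inj_on_le) (auto intro!: finite_PiE)
    then show ?thesis by (simp add: card_PiE)
  qed (simp only: card.empty zero_le)
  have "{T \<in> ST. F q \<subseteq> T} = {T \<in> SK. F q \<subseteq> T}" if "q \<in> P" for q
    using split[OF that] unfolding SK_def by blast
  then have "(\<Sum>q\<in>P. card {T \<in> ST. F q \<subseteq> T}) = (\<Sum>q\<in>P. \<Sum>T | T \<in> SK \<and> F q \<subseteq> T. 1)"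
    by (intro sum.cong) simp_all
  also have "\<dots> = (\<Sum>T\<in>SK. \<Sum>q | q \<in> P \<and> F q \<subseteq> T. 1)"
    using finP finST by (intro sum.swap_restrict) auto
  also have "\<dots> \<le> (\<Sum>T\<in>SK. k ^ k)"
    using mult by (intro sum_mono) auto
  finally have "(\<Sum>q\<in>P. card {T \<in> ST. F q \<subseteq> T}) \<le> card SK * k ^ k" by simp
  then have le: "(\<Sum>q\<in>P. real (card {T \<in> ST. F q \<subseteq> T})) \<le> real (card SK) * real k ^ k"
    unfolding of_nat_sum[symmetric] of_nat_power[symmetric] of_nat_mult[symmetric] of_nat_le_iff .
  have t: "real (card {T \<in> ST. F q \<subseteq> T}) = real N ^ k * real n ^ k / real N ^ 2" if "q \<in> P" for q
  proof -
    obtain xs t where q: "q = (xs, t)" by (cases q)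
    note Fq = F[of xs t, folded q, OF that(1)]
    have "(\<Prod>C\<in>components V (F q). real (card C)) = (\<Prod>C\<in>components V (F q). real n)"
      using Fq(5) by (intro prod.cong) auto
    then show ?thesis
      using card_trees_containing_forest[OF V(1,2) Fq(1,2)] Fq(4) V(3) N
      by (simp add: ST_def field_simps)
  qed
  have cP: "real (card P) = fact N / fact n ^ k * (real n ^ n / real n ^ 2) ^ k"
  proof -
    have "real (card (trees xs)) = (real n ^ n / real n ^ 2) ^ k" if "xs \<in> balanced_colourings k n" for xs
    proof -
      have "real (card (spanning_trees (fibre xs i) (all_edges (fibre xs i)))) = real n ^ n / real n ^ 2"
        if "i < k" for i
        using Cayley[of "fibre xs i"] fib[OF \<open>xs \<in> balanced_colourings k n\<close> that] assms
        by (simp add: field_simps)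
      then show ?thesis by (simp add: trees_def card_PiE)
    qed
    moreover have "card P = (\<Sum>xs\<in>balanced_colourings k n. card (trees xs))"
      unfolding P_def trees_def balanced_colourings_def
      by (intro card_SigmaI ballI finite_PiE finite_permutations_of_multiset finite_spanning_trees fib)
        (auto simp: balanced_colourings_def)
    ultimately have "real (card P) = real (card (balanced_colourings k n)) * (real n ^ n / real n ^ 2) ^ k"
      by simp
    moreover have "real (card (balanced_colourings k n)) * fact n ^ k = fact N"
      using card_balanced_colourings[OF assms(2), of k] unfolding N_def
      by (metis of_nat_fact of_nat_mult of_nat_power)
    then have "real (card (balanced_colourings k n)) = fact N / fact n ^ k"
      by (simp add: eq_divide_eq)
    ultimately show ?thesis by simp
  qed
  have "fact N / (fact n ^ k * real k ^ N) * (real k ^ k * real N ^ N / real N ^ 2) =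
      real (card P) * (real N ^ k * real n ^ k / real N ^ 2)"
  proof -
    have NN: "real N ^ N = real k ^ N * (real n ^ n) ^ k" "real N ^ k = real k ^ k * real n ^ k"
      by (simp_all add: N_def power_mult_distrib power_mult[symmetric] mult.commute)
    have "(real n ^ n / real n ^ 2) ^ k * (real n ^ k * real n ^ k) = (real n ^ n) ^ k"
      using assms by (simp add: power_mult_distrib[symmetric] power2_eq_square)
    then show ?thesis
      unfolding cP NN using assms by (simp add: field_simps)
  qed
  also have "\<dots> \<le> real (card SK) * real k ^ k"
    using le t by simp
  finally have "fact N / (fact n ^ k * real k ^ N) \<le> real (card SK) * real N ^ 2 / real N ^ N"
    using assms N by (simp add: field_simps)
  then show ?thesis by (simp add: SK_def ST_def V_def N_def)
qed

subsection \<open>Asymptotics\<close>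

text \<open>\<open>L n\<close> is the logarithm of the ratio between n! and n^(n+1/2) e^(-n). It
  starts at 1 and decreases: its step is 1 - (n + 1/2) d, where d is the integral of 1/x over
  [n, n+1], bounded below by the midpoint rule and above by the trapezoidal rule.\<close>

lemma ln_fact_bounds:
  assumes "n \<ge> 1"
  shows "(real n + 1 / 2) * ln (real n) - real n \<le> ln (fact n)"
    and "ln (fact n) \<le> (real n + 1 / 2) * ln (real n) - real n + 1"
proof -
  define L where "L n = ln (fact n) - (real n + 1 / 2) * ln (real n) + real n" for n
  \<comment> \<open>The trapezoidal rule limits each decrease to (1/n - 1/(n+1)) / 4. These losses
    telescope, and the 3/4 makes the lower bound equal to L 1 = 1 at n = 1.\<close>
  have "3 / 4 + inverse (real n) / 4 \<le> L n \<and> L n \<le> 1"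
    using assms
  proof (induction n rule: dec_induct)
    case base
    show ?case by (simp add: L_def)
  next
    case (step n)
    define d where "d = ln (real n + 1) - ln (real n)"
    have n: "real n \<ge> 1" using step by simp
    have "fact (Suc n) = (real n + 1) * fact n" by (simp add: algebra_simps)
    then have "ln (fact (Suc n)) = ln (real n + 1) + ln (fact n :: real)"
      using n by (simp add: ln_mult)
    then have L: "L (Suc n) = L n + 1 - (real n + 1 / 2) * d"
      by (simp add: L_def d_def algebra_simps)
    have "d \<ge> 2 / (2 * real n + 1)"
      using ln_inverse_approx_ge[of "real n" "real n + 1"] n by (simp add: d_def add_ac)
    then have "(real n + 1 / 2) * d \<ge> 1" using n by (simp add: field_simps)
    moreover have "(real n + 1 / 2) * d \<le> 1 + inverse (real n) / 4 - inverse (real (Suc n)) / 4"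
    proof -
      define a b where "a = inverse (real n)" and "b = inverse (real n + 1)"
      have "d \<le> (a + b) / 2"
        using ln_inverse_approx_le[of "real n" 1] n by (simp add: d_def a_def b_def)
      then have "(real n + 1 / 2) * d \<le> (real n + 1 / 2) * ((a + b) / 2)"
        using n by (intro mult_left_mono) auto
      also have "\<dots> = ((real n + 1 / 2) * a + (real n + 1 / 2) * b) / 2"
        by (simp only: distrib_left times_divide_eq_right)
      also have "(real n + 1 / 2) * a = 1 + a / 2" using n by (simp add: a_def field_simps)
      also have "(real n + 1 / 2) * b = 1 - b / 2" using n by (simp add: b_def field_simps)
      finally show ?thesis by (simp add: a_def b_def add.commute)
    qed
    ultimately show ?case using step.IH unfolding L by linarith
  qed
  moreover have "0 \<le> inverse (real n)" by simp
  ultimately have "0 \<le> L n" "L n \<le> 1" by linarith+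
  then show "(real n + 1 / 2) * ln (real n) - real n \<le> ln (fact n)"
    "ln (fact n) \<le> (real n + 1 / 2) * ln (real n) - real n + 1"
    by (simp_all add: L_def)
qed

text \<open>Up to logarithms, the terms of order n cancel and leave ln(k) / 2 + (1 - k) / 2 * ln n -
  k. The final -k collects the additive 1 from the upper bounds on the k factors n!; it yields the
  constant exp(-k), and ln(k) / 2 >= 0 is dropped.\<close>

lemma balanced_multinomial_ge:
  assumes "k \<ge> 1" "n \<ge> 1"
  shows "exp (- real k) * real n powr ((1 - real k) / 2) \<le> fact (k * n) / (fact n ^ k * real k ^ (k * n))"
proof -
  define x where "x = ln (real n)"
  have pos: "real k > 0" "real n > 0" using assms by auto
  have lk: "ln (real k) \<ge> 0" using assms by simp
  have kn: "k * n \<ge> 1" using assms by (simp add: Suc_le_eq)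
  have lnkn: "ln (real (k * n)) = ln (real k) + x"
    using pos by (simp add: x_def ln_mult)
  have "real k * ln (fact n) \<le> real k * ((real n + 1 / 2) * x - real n + 1)"
    using ln_fact_bounds(2)[OF assms(2)] by (intro mult_left_mono) (auto simp: x_def)
  moreover have "(real (k * n) + 1 / 2) * (ln (real k) + x) - real (k * n) \<le> ln (fact (k * n))"
    using ln_fact_bounds(1)[OF kn] by (simp only: lnkn)
  moreover have "(real (k * n) + 1 / 2) * (ln (real k) + x) - real (k * n) -
      real k * ((real n + 1 / 2) * x - real n + 1) - real (k * n) * ln (real k) =
      ln (real k) / 2 + (1 - real k) / 2 * x - real k"
    by (simp add: field_simps)
  ultimately have "- real k + (1 - real k) / 2 * x \<le>
      ln (fact (k * n)) - (real k * ln (fact n) + real (k * n) * ln (real k))"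
    using lk by linarith
  also have "\<dots> = ln (fact (k * n) / (fact n ^ k * real k ^ (k * n)))"
    using pos by (simp add: ln_div ln_mult ln_realpow)
  finally have "exp (- real k + (1 - real k) / 2 * x) \<le> fact (k * n) / (fact n ^ k * real k ^ (k * n))"
    using pos by (subst (asm) ln_ge_iff) auto
  moreover have "real n powr ((1 - real k) / 2) = exp ((1 - real k) / 2 * x)"
    using pos by (simp add: powr_def x_def)
  ultimately show ?thesis by (simp only: exp_add)
qed

lemma split_prob_powr_ge:
  assumes "k \<ge> 1" "n \<ge> 1" "3 \<le> k * n" "2 * (k * n) \<le> m" "m \<le> (k * n) choose 2"
  shows "exp (- real k) * real n powr ((1 - real k) / 2) *
      exp (- 2 / (real m / real ((k * n) choose 2))) \<le> split_prob k (k * n) m"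
proof -
  have "exp (- real k) * real n powr ((1 - real k) / 2) \<le>
      real (card {T \<in> spanning_trees {..<k * n} (all_edges {..<k * n}). k_splittable k {..<k * n} T}) *
      real (k * n) ^ 2 / real (k * n) ^ (k * n)"
    using balanced_multinomial_ge[of k n] card_splittable_trees_ge[of k n] assms by linarith
  then show ?thesis
    using split_prob_ge[OF assms(3-5), of k]
    by (meson mult_right_mono exp_ge_zero order_trans)
qed

text \<open>Used to obtain m >= 2 N from the density hypothesis: c M / ln n >= 2 N means 4 ln n <= c
  (N - 1), and N >= n.\<close>

lemma eventually_ln_le_linear:
  assumes "c > 0"
  shows "\<forall>\<^sub>F n in sequentially. 4 * ln (real n) \<le> c * (real n - 1)"
proof -
  have "(\<lambda>n. ln (real n) / real n) \<longlonglongrightarrow> 0" by (rule lim_ln_over_n)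
  then have "\<forall>\<^sub>F n in sequentially. ln (real n) / real n < c / 8"
    using assms by (intro order_tendstoD) auto
  then show ?thesis
    using eventually_ge_at_top[of 2]
  proof eventually_elim
    case (elim n)
    then have "8 * ln (real n) \<le> c * real n" by (simp add: field_simps)
    moreover have "c * real n \<ge> c * 2" using elim assms by (intro mult_left_mono) auto
    ultimately show ?case by (simp add: algebra_simps)
  qed
qed

theorem theorem4:
  fixes k :: nat
  assumes "k \<ge> 2"
  shows "\<exists>C > 0. \<forall>m :: nat \<Rightarrow> nat.
    (\<forall>n. m n \<le> (k * n) choose 2) \<longrightarrow>
    (\<exists>c > 0. \<forall>\<^sub>F n in sequentially. real (m n) \<ge> c * real ((k * n) choose 2) / ln (real n)) \<longrightarrow>
    (let p = (\<lambda>n. real (m n) / real ((k * n) choose 2)) in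
      (\<exists>\<epsilon> :: nat \<Rightarrow> real. \<epsilon> \<longlonglongrightarrow> 0 \<and>
         (\<forall>\<^sub>F n in sequentially.
            split_prob k (k * n) (m n) \<ge>
              C * real n powr ((1 - real k) / 2) * p n * exp (- (2 + \<epsilon> n) / p n)))
      \<and> (\<exists>D. \<forall>\<^sub>F n in sequentially.
            split_prob k (k * n) (m n) \<ge> C * real n powr (- real k / 2 - D)))"
proof (intro exI[of _ "exp (- real k)"] conjI allI impI)
  fix m :: "nat \<Rightarrow> nat"
  assume m_le: "\<forall>n. m n \<le> (k * n) choose 2"
  assume "\<exists>c > 0. \<forall>\<^sub>F n in sequentially. real (m n) \<ge> c * real ((k * n) choose 2) / ln (real n)"
  then obtain c where c: "c > 0"
    and m_ge: "\<forall>\<^sub>F n in sequentially. real (m n) \<ge> c * real ((k * n) choose 2) / ln (real n)" by blast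
  define p where "p n = real (m n) / real ((k * n) choose 2)" for n
  have main: "\<forall>\<^sub>F n in sequentially. n \<ge> 2 \<and> 0 < p n \<and> p n \<le> 1 \<and> c / ln (real n) \<le> p n \<and>
      exp (- real k) * real n powr ((1 - real k) / 2) * exp (- 2 / p n) \<le> split_prob k (k * n) (m n)"
    using m_ge eventually_ln_le_linear[OF c] eventually_ge_at_top[of 2]
  proof eventually_elim
    case (elim n)
    have ln: "ln (real n) > 0" using elim by simp
    have kn: "k * n \<ge> 2 * n" using assms by simp
    then have kn3: "3 \<le> k * n" using elim by linarith
    have M: "real ((k * n) choose 2) = real (k * n) * (real (k * n) - 1) / 2"
      by (rule real_choose_two)
    have "real (k * n) \<ge> 3" using kn3 by (metis of_nat_le_iff of_nat_numeral)
    then have M0: "real ((k * n) choose 2) > 0"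
      unfolding M by (intro divide_pos_pos mult_pos_pos) linarith+
    have "2 * real (k * n) * ln (real n) \<le> real (k * n) * (c * (real n - 1) / 2)"
      using mult_left_mono[OF elim(2), of "real (k * n) / 2"] by (simp add: algebra_simps)
    also have "\<dots> \<le> real (k * n) * (c * (real (k * n) - 1) / 2)"
    proof (intro mult_left_mono divide_right_mono)
      have "n \<le> k * n" using kn by linarith
      then have "real n \<le> real (k * n)" by (simp only: of_nat_le_iff)
      then show "real n - 1 \<le> real (k * n) - 1" by linarith
    qed (use c in auto)
    also have "\<dots> = c * real ((k * n) choose 2)" unfolding M by simp
    finally have "2 * real (k * n) \<le> c * real ((k * n) choose 2) / ln (real n)"
      using ln by (simp add: field_simps)
    then have "real (2 * (k * n)) \<le> real (m n)" using elim(1) by simp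
    then have m2: "2 * (k * n) \<le> m n" by (simp only: of_nat_le_iff)
    have "p n > 0" "p n \<le> 1" using m2 kn3 M0 m_le by (auto simp: p_def)
    moreover have "c / ln (real n) \<le> p n"
      using elim(1) M0 ln by (simp add: p_def field_simps)
    moreover have "exp (- real k) * real n powr ((1 - real k) / 2) * exp (- 2 / p n) \<le>
        split_prob k (k * n) (m n)"
      unfolding p_def using assms elim kn3 m2 m_le by (intro split_prob_powr_ge) auto
    ultimately show ?case using elim(3) by blast
  qed
  have "\<forall>\<^sub>F n in sequentially. split_prob k (k * n) (m n) \<ge>
      exp (- real k) * real n powr ((1 - real k) / 2) * p n * exp (- (2 + 0) / p n)"
    using main
  proof eventually_elim
    case (elim n)
    \<comment> \<open>The factor p of the claim is at most 1, so it only weakens the bound already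
      proved.\<close>
    have "exp (- real k) * real n powr ((1 - real k) / 2) * p n * exp (- 2 / p n) \<le>
        exp (- real k) * real n powr ((1 - real k) / 2) * 1 * exp (- 2 / p n)"
      using elim by (intro mult_right_mono mult_left_mono) auto
    also have "\<dots> \<le> split_prob k (k * n) (m n)" using elim by simp
    finally show ?case by simp
  qed
  moreover have "\<forall>\<^sub>F n in sequentially. split_prob k (k * n) (m n) \<ge>
      exp (- real k) * real n powr (- real k / 2 - 2 / c)"
    using main
  proof eventually_elim
    case (elim n)
    have ln: "ln (real n) > 0" using elim by simp
    \<comment> \<open>From p >= c / ln n follows exp(-2/p) >= n^(-2/c), which is why
      \<open>2 / c\<close> is the witness for \<open>D\<close>.\<close>
    have "1 / p n \<le> 1 / (c / ln (real n))"
      using elim c ln by (intro divide_left_mono mult_pos_pos) auto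
    then have e: "- (2 / c) * ln (real n) \<le> - 2 / p n" by simp
    have "real n powr (- real k / 2 - 2 / c) \<le> real n powr ((1 - real k) / 2 - 2 / c)"
      using elim by (intro powr_mono) (auto simp: field_simps)
    also have "\<dots> = real n powr ((1 - real k) / 2) * exp (- (2 / c) * ln (real n))"
      using elim by (simp add: powr_def exp_add[symmetric] algebra_simps)
    also have "\<dots> \<le> real n powr ((1 - real k) / 2) * exp (- 2 / p n)"
      using e by (intro mult_left_mono) auto
    finally have "exp (- real k) * real n powr (- real k / 2 - 2 / c) \<le>
        exp (- real k) * (real n powr ((1 - real k) / 2) * exp (- 2 / p n))"
      by (intro mult_left_mono) auto
    also have "\<dots> \<le> split_prob k (k * n) (m n)" using elim by (simp add: mult.assoc)
    finally show ?case .
  qed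
  ultimately show "let p = (\<lambda>n. real (m n) / real ((k * n) choose 2)) in
      (\<exists>\<epsilon> :: nat \<Rightarrow> real. \<epsilon> \<longlonglongrightarrow> 0 \<and>
         (\<forall>\<^sub>F n in sequentially.
            split_prob k (k * n) (m n) \<ge>
              exp (- real k) * real n powr ((1 - real k) / 2) * p n * exp (- (2 + \<epsilon> n) / p n)))
      \<and> (\<exists>D. \<forall>\<^sub>F n in sequentially.
            split_prob k (k * n) (m n) \<ge> exp (- real k) * real n powr (- real k / 2 - D))"
    unfolding Let_def p_def by (intro conjI exI[of _ "\<lambda>_. 0"] exI[of _ "2 / c"] tendsto_const)
qed simp

end
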